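(* Let $N\ge 1$ and consider two cyclic Pólya ensembles on $\mathrm U(N)$ associated to weights $\omega_1,\omega_2\in\widetilde L^1_N(\mathbb S_1)$, with Laurent coefficients $u^{(i)}_s=\mathcal S\omega_i(s)$, $s\in\mathbb Z$, $i=1,2$. Suppose that there is an integer $s_0\notin\{0,1,\ldots,N-1\}$ with $u^{(1)}_{s_0}\neq0$ and $u^{(2)}_{s_0}\neq0$. If the joint probability densities of the eigenvalues of the two ensembles agree, then the two weights differ at most by a global normalisation constant $C$. More precisely, if $N=2M+1$ is odd there is a real $C>0$, and if $N=2M$ is even there is a real $C\neq0$, such that $\omega_1(z')=C\,\omega_2(z')$ for almost all $z'\in\mathbb S_1$.
   Context: $\mathbb S_1=\{z\in\mathbb C: |z|=1\}$ carries the normalised Haar measure $\frac{dz'}{2\pi i z'}$ (i.e. $\frac{d\theta}{2\pi}$ for $z'=e^{i\theta}$); $L^1(\mathbb S_1)$ refers to it and functions are identified when equal almost everywhere. A star denotes complex conjugation, and $\partial_{z'}$ is the derivative along $\mathbb S_1$ normalised so that $z'\partial_{z'}=-i\,\frac{d}{d\theta}$. $\Delta_N(z)=\prod_{1\le a<b\le N}(z_b-z_a)$. For $w\in L^1(\mathbb S_1)$ and $s\in\mathbb Z$, $\mathcal Sw(s)=\int_{\mathbb S_1}\frac{dz'}{2\pi i z'}{z'}^{s}w(z')$, so that $w$ has the Laurent (Fourier) series $\sum_{s\in\mathbb Z}\mathcal Sw(s){z'}^{-s}$. $L_N^1(\mathbb S_1)=\{w\in L^1(\mathbb S_1): [w(z)]^*=z^{N-1}w(z)\}$.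 $\widetilde L_N^1(\mathbb S_1)$ is the set of $w\in L_N^1(\mathbb S_1)$ that are $(N-1)$-times differentiable with $\partial^jw\in L^1(\mathbb S_1)$ for $j=0,\ldots,N-1$; here this means that for $N\ge2$ $w$ is $(N-2)$-times continuously differentiable with $\partial^{N-2}w$ absolutely continuous, so that $\partial^{N-1}w$ need only exist almost everywhere. Cyclic Pólya ensemble: a unitarily invariant random matrix $U\in\mathrm U(N)$ (its distribution is invariant under $U\mapsto VUV^\dagger$ for all $V\in\mathrm U(N)$) is drawn from the cyclic Pólya ensemble associated to the weight $\omega\in\widetilde L_N^1(\mathbb S_1)$ iff its eigenvalues $z_1,\ldots,z_N\in\mathbb S_1$ have joint probability density, with respect to $\prod_{j=1}^N\frac{dz_j}{2\pi i z_j}$ on $\mathbb S_1^N$, $$p_N^{(U)}(z)=\frac{1}{N!\prod_{j=0}^{N-1}[j!\,\mathcal S\omega(j)]}\,\Delta_N(z)\det[(-z_a\partial_{z_a})^{b-1}\omega(z_a)]_{a,b=1,\ldots,N}\ge0 .$$ It is part of the definition that $\prod_{j=0}^{N-1}\mathcal S\omega(j)>0$ (in particular $\mathcal S\omega(j)\ne0$ for $j=0,\ldots,N-1$). *)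

theory Defs
  imports
    "HOL-Probability.Probability"
    "HOL-Computational_Algebra.Fundamental_Theorem_Algebra"
    "Jordan_Normal_Form.Char_Poly"
    "Jordan_Normal_Form.Schur_Decomposition"
begin

definition circle_measure :: "complex measure" where
  "circle_measure =
     distr (uniform_measure lborel {0..2 * pi}) (restrict_space borel (sphere 0 1)) cis"

definition laurent_coeff :: "(complex \<Rightarrow> complex) \<Rightarrow> int \<Rightarrow> complex" where
  "laurent_coeff w s = (\<integral>z. z powi s * w z \<partial>circle_measure)"

text \<open>
  The derivative along the circle is normalised so that \<open>z \<cdot> \<partial>\<^sub>z = - \<i> d/d\<theta>\<close> for \<open>z = cis \<theta>\<close>.
  Only the values of \<open>w\<close> on the unit circle enter when \<open>z\<close> lies on the unit circle.
\<close>

definition circle_differentiable :: "(complex \<Rightarrow> complex) \<Rightarrow> complex \<Rightarrow> bool" where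
  "circle_differentiable w z \<longleftrightarrow> (\<lambda>t::real. w (z * cis t)) differentiable (at 0)"

definition circle_deriv :: "(complex \<Rightarrow> complex) \<Rightarrow> complex \<Rightarrow> complex" where
  "circle_deriv w z = - \<i> / z * vector_derivative (\<lambda>t::real. w (z * cis t)) (at 0)"

definition abs_continuous_on_interval :: "real \<Rightarrow> real \<Rightarrow> (real \<Rightarrow> complex) \<Rightarrow> bool" where
  "abs_continuous_on_interval a b f \<longleftrightarrow>
     (\<forall>\<epsilon>>0. \<exists>\<delta>>0. \<forall>D. finite D \<longrightarrow> D \<subseteq> {(x, y). a \<le> x \<and> x \<le> y \<and> y \<le> b} \<longrightarrow>
        disjoint_family_on (\<lambda>(x, y). {x<..<y}) D \<longrightarrow>
        (\<Sum>(x, y)\<in>D. y - x) < \<delta> \<longrightarrow> (\<Sum>(x, y)\<in>D. norm (f y - f x)) < \<epsilon>)"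

definition L1_sym :: "nat \<Rightarrow> (complex \<Rightarrow> complex) set" where
  "L1_sym N = {w. integrable circle_measure w \<and>
     (AE z in circle_measure. cnj (w z) = z ^ (N - 1) * w z)}"

text \<open>
  Weights are given by functions rather than by classes of almost everywhere equal functions; for
  \<open>N \<ge> 2\<close> the regularity conditions therefore select the continuous representative of the class.
  The derivative of order \<open>N - 1\<close> need only exist almost everywhere.
\<close>

definition L1_sym_diff :: "nat \<Rightarrow> (complex \<Rightarrow> complex) set" where
  "L1_sym_diff N = {w \<in> L1_sym N.
     (\<forall>j<N. integrable circle_measure ((circle_deriv ^^ j) w)) \<and>
     (N \<ge> 2 \<longrightarrow>
        (\<forall>j<N - 2. \<forall>z\<in>sphere 0 1. circle_differentiable ((circle_deriv ^^ j) w) z) \<and>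
        (\<forall>j\<le>N - 2. continuous_on (sphere 0 1) ((circle_deriv ^^ j) w)) \<and>
        abs_continuous_on_interval 0 (2 * pi) (\<lambda>\<theta>. (circle_deriv ^^ (N - 2)) w (cis \<theta>)) \<and>
        (AE z in circle_measure. circle_differentiable ((circle_deriv ^^ (N - 2)) w) z))}"

definition torus_measure :: "nat \<Rightarrow> (nat \<Rightarrow> complex) measure" where
  "torus_measure N = PiM {..<N} (\<lambda>_. circle_measure)"

definition vandermonde :: "nat \<Rightarrow> (nat \<Rightarrow> complex) \<Rightarrow> complex" where
  "vandermonde N z = (\<Prod>b<N. \<Prod>a<b. z b - z a)"

text \<open>Indices run from \<open>0\<close> to \<open>N - 1\<close>, so the column \<open>b\<close> carries the power \<open>b\<close> of \<open>- z \<cdot> \<partial>\<^sub>z\<close>.\<close>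

definition polya_density ::
  "nat \<Rightarrow> (complex \<Rightarrow> complex) \<Rightarrow> (nat \<Rightarrow> complex) \<Rightarrow> complex" where
  "polya_density N \<omega> z =
     1 / (fact N * (\<Prod>j<N. fact j * laurent_coeff \<omega> (int j))) * vandermonde N z *
     Determinant.det (mat N N (\<lambda>(a, b). ((\<lambda>f x. - x * circle_deriv f x) ^^ b) \<omega> (z a)))"

definition unitary_group :: "nat \<Rightarrow> complex mat set" where
  "unitary_group N = {U \<in> carrier_mat N N. mat_adjoint U * U = 1\<^sub>m N}"

text \<open>The Borel sigma-algebra of the unitary group as a subspace of the space of all
  \<open>N \<times> N\<close> matrices.\<close>

definition unitary_borel :: "nat \<Rightarrow> complex mat measure" where
  "unitary_borel N = vimage_algebra (unitary_group N)
     (\<lambda>U. \<lambda>ij\<in>{..<N} \<times> {..<N}. U $$ ij) (PiM ({..<N} \<times> {..<N}) (\<lambda>_. borel))"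

text \<open>
  The eigenvalues of a matrix are unordered, so their joint density with respect to labelled
  \<open>N\<close>-tuples is tested on events that are invariant under permutations of the labels.
\<close>

definition has_eigenvalue_density ::
  "nat \<Rightarrow> complex mat measure \<Rightarrow> ((nat \<Rightarrow> complex) \<Rightarrow> complex) \<Rightarrow> bool" where
  "has_eigenvalue_density N M p \<longleftrightarrow>
     p \<in> borel_measurable (torus_measure N) \<and>
     (AE z in torus_measure N. p z \<in> \<real>\<^sub>\<ge>\<^sub>0) \<and>
     (\<forall>B\<in>sets (torus_measure N).
        (\<forall>\<pi>. \<pi> permutes {..<N} \<longrightarrow> (\<forall>z\<in>B. z \<circ> \<pi> \<in> B)) \<longrightarrow>
        emeasure M {U \<in> space M. \<exists>z\<in>B. proots (char_poly U) = image_mset z (mset_set {..<N})} =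
        (\<integral>\<^sup>+z\<in>B. ennreal (Re (p z)) \<partial>torus_measure N))"

text \<open>An ensemble is the distribution of a random matrix, that is, a probability measure on the
  unitary group.\<close>

definition cyclic_polya_ensemble ::
  "nat \<Rightarrow> (complex \<Rightarrow> complex) \<Rightarrow> complex mat measure \<Rightarrow> bool" where
  "cyclic_polya_ensemble N \<omega> M \<longleftrightarrow>
     \<omega> \<in> L1_sym_diff N \<and>
     (\<Prod>j<N. laurent_coeff \<omega> (int j)) \<in> \<real> \<and> Re (\<Prod>j<N. laurent_coeff \<omega> (int j)) > 0 \<and>
     prob_space M \<and> sets M = sets (unitary_borel N) \<and>
     (\<forall>V\<in>unitary_group N. distr M (unitary_borel N) (\<lambda>U. V * U * mat_adjoint V) = M) \<and>
     has_eigenvalue_density N M (polya_density N \<omega>)"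

end

theory Submission
  imports Defs "HOL-Combinatorics.Stirling"
begin

text \<open>
  Off a null set the Vandermonde factor of the density does not vanish, so the two determinants agree
  up to a constant. Since \<open>(- z \<cdot> \<partial>)\<^sup>b\<close> multiplies the Laurent coefficient of index \<open>s\<close> by \<open>s\<^sup>b\<close>, the
  Fourier coefficient of the determinant at distinct frequencies \<open>s\<^sub>1, \<dots>, s\<^sub>N\<close> is \<open>\<Prod>\<^sub>a u(s\<^sub>a)\<close> times a
  nonzero Vandermonde determinant. Comparing the frequencies \<open>0, \<dots>, N - 1\<close> with those in which one
  \<open>j\<close> is replaced by an outside index \<open>t\<close> shows that \<open>u(t) / u(j)\<close> is the same for both weights.
  Taking \<open>t = s\<^sub>0\<close> first, all ratios of coefficients equal one constant \<open>C\<close>; it is real by the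
  symmetry \<open>u(s)\<^sup>* = u(N - 1 - s)\<close>, and \<open>C\<^sup>N > 0\<close> by the normalisation.
  The derivative of order \<open>N - 1\<close> exists only almost everywhere, hence the need for the fundamental
  theorem of calculus for absolutely continuous functions.
\<close>

subsection \<open>Absolutely continuous functions\<close>

text \<open>The index \<open>s\<^sub>0\<close> is what ties the inner coefficients together. If all
  outer coefficients vanished, the determinant would have nonzero Fourier coefficients only at
  permutations of 0, ..., N - 1, and there the normalisation cancels the product of the u(j); the
  ratios between the u(j) would leave no trace in the density. The obstacle is regularity.
  Membership in \<open>L1_sym_diff\<close> controls the plain derivatives of the weight, whereas the
  density contains powers of the Euler operator; Stirling numbers of the second kind convert one
  into the other. A power can be differentiated again only if its expansion holds along the whole
  circle, which is the case for all orders but the last. The last order is known almost everywhere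
  only, so the determinant is compared with one built from integrable representatives.\<close>

lemma abs_continuous_on_intervalD:
  assumes "abs_continuous_on_interval a b f" "\<epsilon> > 0"
  obtains \<delta> where "\<delta> > 0"
    "\<And>D. finite D \<Longrightarrow> D \<subseteq> {(x, y). a \<le> x \<and> x \<le> y \<and> y \<le> b} \<Longrightarrow>
        disjoint_family_on (\<lambda>(x, y). {x<..<y}) D \<Longrightarrow>
        (\<Sum>(x, y)\<in>D. y - x) < \<delta> \<Longrightarrow> (\<Sum>(x, y)\<in>D. norm (f y - f x)) < \<epsilon>"
  using assms unfolding abs_continuous_on_interval_def by meson

text \<open>Supplies the bound on the total length that the definition of absolute continuity asks
  for, once the intervals are known to lie in a set of small measure.\<close>

lemma sum_open_intervals_le_measure:
  fixes D :: "(real \<times> real) set"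
  assumes "finite D" "D \<subseteq> {(x, y). x \<le> y}"
    and "disjoint_family_on (\<lambda>(x, y). {x<..<y}) D"
    and "(\<Union>(x, y)\<in>D. {x<..<y}) \<subseteq> G" "G \<in> lmeasurable"
  shows "(\<Sum>(x, y)\<in>D. y - x) \<le> measure lebesgue G"
proof -
  have "(\<Sum>(x, y)\<in>D. y - x) = (\<Sum>p\<in>D. measure lebesgue ((\<lambda>(x, y). {x<..<y}) p))"
    using assms(2) by (intro sum.cong) auto
  also have "\<dots> = measure lebesgue (\<Union>p\<in>D. (\<lambda>(x, y). {x<..<y}) p)"
  proof (rule measure_finite_Union[symmetric])
    show "emeasure lebesgue ((\<lambda>(x, y). {x<..<y}) p) \<noteq> \<infinity>" for p :: "real \<times> real"
      by (cases p, cases "fst p \<le> snd p") auto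
  qed (use assms(1,3) in auto)
  also have "\<dots> \<le> measure lebesgue G"
    using assms(1,4,5) by (intro measure_mono_fmeasurable) auto
  finally show ?thesis .
qed

text \<open>Subintervals whose tags lie in the exceptional null set are covered by an open set of small
  measure, so absolute continuity makes their increments negligible.\<close>

lemma abs_continuous_small_on_null:
  fixes f :: "real \<Rightarrow> complex"
  assumes ac: "abs_continuous_on_interval a b f" and E: "negligible E" and e: "e > 0"
  obtains G where "open G" "E \<subseteq> G"
    "\<And>p. p tagged_division_of {a..b} \<Longrightarrow> 
      (\<Sum>(x, K)\<in>{(x, K) \<in> p. K \<subseteq> G}. norm (f (Sup K) - f (Inf K))) < e"
proof -
  obtain \<delta> where \<delta>: "\<delta> > 0"
    "\<And>D. finite D \<Longrightarrow> D \<subseteq> {(x, y). a \<le> x \<and> x \<le> y \<and> y \<le> b} \<Longrightarrow>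
        disjoint_family_on (\<lambda>(x, y). {x<..<y}) D \<Longrightarrow>
        (\<Sum>(x, y)\<in>D. y - x) < \<delta> \<Longrightarrow> (\<Sum>(x, y)\<in>D. norm (f y - f x)) < e"
    using abs_continuous_on_intervalD[OF ac e] by blast
  have "E \<in> sets lebesgue" using E by (simp add: negligible_imp_sets)
  then obtain G where G: "open G" "E \<subseteq> G" "G - E \<in> lmeasurable" "emeasure lebesgue (G - E) < ennreal \<delta>"
    using sets_lebesgue_outer_open \<delta>(1) by blast
  have GE: "G = (G - E) \<union> E" using G(2) by blast
  have Gm: "G \<in> lmeasurable" using G(3) E GE negligible_imp_measurable fmeasurable.Un by metis
  have "measure lebesgue G = measure lebesgue (G - E)"
    using E G(2) by (intro measure_negligible_symdiff) (auto simp: G(3) fmeasurableD Un_absorb1 Diff_Diff_Int negligible_Int)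
  also have "\<dots> < \<delta>"
    using G(3,4) \<delta>(1) by (metis emeasure_eq_measure2 ennreal_less_iff measure_nonneg)
  finally have Gd: "measure lebesgue G < \<delta>" .
  show ?thesis
  proof (rule that[OF G(1,2)])
    fix p assume p: "p tagged_division_of {a..b}"
    have fin: "finite p" using p by blast
    have int: "K = {Inf K..Sup K} \<and> Inf K \<le> Sup K \<and> a \<le> Inf K \<and> Sup K \<le> b" if "(x, K) \<in> p" for x K
    proof -
      obtain u v where K: "K = cbox u v" using tagged_division_ofD(4)[OF p \<open>(x, K) \<in> p\<close>] by (elim exE)
      have "x \<in> K" "K \<subseteq> {a..b}" using p that by auto
      then show ?thesis using K by auto
    qed
    \<comment> \<open>Degenerate intervals have zero increment and are dropped. For the remaining
      ones, equal endpoints would mean overlapping interiors, so \<open>h\<close> is injective and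
      the sum over tagged intervals becomes a sum over endpoint pairs.\<close>
    define q where "q = {(x, K) \<in> p. K \<subseteq> G \<and> Inf K < Sup K}"
    define h where "h = (\<lambda>(x::real, K::real set). (Inf K, Sup K))"
    have qp: "q \<subseteq> p" by (auto simp: q_def)
    then have finq: "finite q" using fin finite_subset by blast
    have disj: "{Inf K<..<Sup K} \<inter> {Inf L<..<Sup L} = {}" if "(x, K) \<in> p" "(y, L) \<in> p" "(x, K) \<noteq> (y, L)" for x K y L
    proof -
      have "interior K \<inter> interior L = {}"
        using tagged_division_ofD(5)[OF p that] .
      then show ?thesis using int[OF that(1)] int[OF that(2)] interior_atLeastAtMost_real by metis
    qed
    have inj: "inj_on h q"
    proof (rule inj_onI, clarify)
      fix x K y L assume *: "(x, K) \<in> q" "(y, L) \<in> q" "h (x, K) = h (y, L)"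
      then have "Inf K = Inf L" "Sup K = Sup L" "Inf K < Sup K" by (auto simp: h_def q_def)
      then have "{Inf K<..<Sup K} \<inter> {Inf L<..<Sup L} \<noteq> {}" by simp
      then show "x = y \<and> K = L" using disj * qp by blast
    qed
    have "(\<Sum>(x, K)\<in>{(x, K) \<in> p. K \<subseteq> G}. norm (f (Sup K) - f (Inf K))) = (\<Sum>(x, K)\<in>q. norm (f (Sup K) - f (Inf K)))"
    proof (rule sum.mono_neutral_right)
      show "finite {(x, K) \<in> p. K \<subseteq> G}" by (rule finite_subset[OF _ fin]) auto
      show "q \<subseteq> {(x, K) \<in> p. K \<subseteq> G}" by (auto simp: q_def)
      show "\<forall>i\<in>{(x, K) \<in> p. K \<subseteq> G} - q. (case i of (x, K) \<Rightarrow> norm (f (Sup K) - f (Inf K))) = 0"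
      proof clarify
        fix x K assume *: "(x, K) \<in> p" "K \<subseteq> G" "(x, K) \<notin> q"
        then have "Inf K = Sup K" using int[OF *(1)] by (auto simp: q_def)
        then show "norm (f (Sup K) - f (Inf K)) = 0" by simp
      qed
    qed
    also have "\<dots> = (\<Sum>(x, y)\<in>h ` q. norm (f y - f x))"
      by (subst sum.reindex[OF inj]) (auto simp: h_def intro!: sum.cong)
    also have "\<dots> < e"
    proof (rule \<delta>(2))
      show "finite (h ` q)" using finq by simp
      show "h ` q \<subseteq> {(x, y). a \<le> x \<and> x \<le> y \<and> y \<le> b}"
        using int qp by (fastforce simp: h_def)
      show dj: "disjoint_family_on (\<lambda>(x, y). {x<..<y}) (h ` q)"
        unfolding disjoint_family_on_def
      proof (intro ballI impI)
        fix P Q assume "P \<in> h ` q" "Q \<in> h ` q" "P \<noteq> Q"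
        then obtain x K y L where *: "(x, K) \<in> q" "(y, L) \<in> q" "P = h (x, K)" "Q = h (y, L)" by fast
        with \<open>P \<noteq> Q\<close> have "(x, K) \<noteq> (y, L)" by blast
        then show "(case P of (x, y) \<Rightarrow> {x<..<y}) \<inter> (case Q of (x, y) \<Rightarrow> {x<..<y}) = {}"
          using disj[of x K y L] * qp by (simp add: h_def subsetD)
      qed
      have "(\<Sum>(x, y)\<in>h ` q. y - x) \<le> measure lebesgue G"
      proof (rule sum_open_intervals_le_measure)
        show "(\<Union>(x, y)\<in>h ` q. {x<..<y}) \<subseteq> G"
        proof
          fix t assume "t \<in> (\<Union>(x, y)\<in>h ` q. {x<..<y})"
          then obtain x K where *: "(x, K) \<in> q" "t \<in> {Inf K<..<Sup K}" by (auto simp: h_def)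
          have "K = {Inf K..Sup K}" using int * qp by blast
          then have "t \<in> K" using * by (metis greaterThanLessThan_iff atLeastAtMost_iff less_imp_le)
          then show "t \<in> G" using * by (auto simp: q_def)
        qed
        show "h ` q \<subseteq> {(x, y). x \<le> y}" by (auto simp: h_def q_def)
      qed (use finq dj Gm in auto)
      then show "(\<Sum>(x, y)\<in>h ` q. y - x) < \<delta>" using Gd by simp
    qed
    finally show "(\<Sum>(x, K)\<in>{(x, K) \<in> p. K \<subseteq> G}. norm (f (Sup K) - f (Inf K))) < e" .
  qed
qed

text \<open>Works directly with the gauge integral, so that integrability of the derivative is a
  conclusion. The gauge is chosen by the kind of tag: outside \<open>E\<close> from
  differentiability, with error e/2 per unit length; in \<open>E\<close> so small that the
  subinterval lies in the open set \<open>G\<close>, where absolute continuity bounds the total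
  increment.\<close>

lemma abs_continuous_has_integral:
  fixes f :: "real \<Rightarrow> complex"
  assumes ab: "a < b" and ac: "abs_continuous_on_interval a b f" and E: "negligible E"
    and deriv: "\<And>x. x \<in> {a..b} - E \<Longrightarrow> (f has_vector_derivative f' x) (at x within {a..b})"
  shows "(f' has_integral (f b - f a)) {a..b}"
proof -
  \<comment> \<open>The values of \<open>f'\<close> on \<open>E\<close> are arbitrary; with 0 there,
    a tag in \<open>E\<close> contributes nothing but the increment of \<open>f\<close>.\<close>
  define F where "F = (\<lambda>x. if x \<in> E then 0 else f' x)"
  have "(F has_integral (f b - f a)) {a..b}"
    unfolding has_integral_factor_content_real
  proof (intro allI impI)
    fix e :: real assume e: "e > 0"
    \<comment> \<open>Half of the admissible error; the tags outside \<open>E\<close> account for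
      the other half.\<close>
    define e1 where "e1 = e * (b - a) / 2"
    have e1: "e1 > 0" using e ab by (simp add: e1_def)
    obtain G where G: "open G" "E \<subseteq> G"
      and Gs: "\<And>p. p tagged_division_of {a..b} \<Longrightarrow> 
        (\<Sum>(x, K)\<in>{(x, K) \<in> p. K \<subseteq> G}. norm (f (Sup K) - f (Inf K))) < e1"
      by (rule abs_continuous_small_on_null[OF ac E e1]) blast
    have "\<forall>x. \<exists>d>0. (x \<in> E \<longrightarrow> ball x d \<subseteq> G) \<and> (x \<in> {a..b} - E \<longrightarrow>
         (\<forall>y\<in>{a..b}. norm (y-x) < d \<longrightarrow> norm (f y - f x - (y-x) *\<^sub>R f' x) \<le> e/2 * norm (y-x)))"
    proof
      fix x
      show "\<exists>d>0. (x \<in> E \<longrightarrow> ball x d \<subseteq> G) \<and> (x \<in> {a..b} - E \<longrightarrow>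
         (\<forall>y\<in>{a..b}. norm (y-x) < d \<longrightarrow> norm (f y - f x - (y-x) *\<^sub>R f' x) \<le> e/2 * norm (y-x)))"
      proof (cases "x \<in> E")
        case True
        then show ?thesis using G open_contains_ball by (metis DiffD2 subsetD)
      next
        case False
        show ?thesis
        proof (cases "x \<in> {a..b}")
          case True
          then have "x \<in> {a..b} - E" using False by simp
          from deriv[OF this] have "\<exists>d>0. \<forall>y\<in>{a..b}. norm (y-x) < d \<longrightarrow> 
              norm (f y - f x - (y-x) *\<^sub>R f' x) \<le> e/2 * norm (y-x)"
            using e half_gt_zero[OF e] unfolding has_vector_derivative_def has_derivative_within_alt
            by blast
          then show ?thesis using False by blast
        next
          case F2: False
          then show ?thesis using False by (intro exI[of _ 1]) auto
        qed
      qed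
    qed
    then obtain d where d: "\<And>x. 0 < d x" "\<And>x. x \<in> E \<Longrightarrow> ball x (d x) \<subseteq> G"
      "\<And>x y. x \<in> {a..b} - E \<Longrightarrow> y \<in> {a..b} \<Longrightarrow> norm (y-x) < d x \<Longrightarrow>
          norm (f y - f x - (y-x) *\<^sub>R f' x) \<le> e/2 * norm (y-x)"
      by metis
    show "\<exists>d. gauge d \<and> (\<forall>p. p tagged_division_of {a..b} \<and> d fine p \<longrightarrow>
      norm ((\<Sum>(x, k)\<in>p. measure lborel k *\<^sub>R F x) - (f b - f a)) \<le> e * measure lborel {a..b})"
    proof (intro exI conjI allI impI; (elim conjE)?)
      show "gauge (\<lambda>x. ball x (d x))" using d(1) gauge_ball_dependent by blast
    next
      fix p assume p: "p tagged_division_of {a..b}" and fine: "(\<lambda>x. ball x (d x)) fine p"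
      have fin: "finite p" using p by blast
      have ba: "b - a = (\<Sum>(x,K)\<in>p. Sup K - Inf K)" "f b - f a = (\<Sum>(x,K)\<in>p. f(Sup K) - f(Inf K))"
        using additive_tagged_division_1[OF less_imp_le[OF ab] p, where f = "\<lambda>x. x"]
          additive_tagged_division_1[OF less_imp_le[OF ab] p, where f = f] by simp_all
      have "norm ((\<Sum>(x, k)\<in>p. measure lborel k *\<^sub>R F x) - (f b - f a)) =
         norm (\<Sum>(x, K)\<in>p. measure lborel K *\<^sub>R F x - (f (Sup K) - f (Inf K)))"
        unfolding ba(2) by (simp add: sum_subtractf case_prod_unfold)
      \<comment> \<open>Both error terms are charged to every tag. The second one is needed for tags
        in \<open>E\<close>; being nonnegative, it may stay for other intervals that happen to lie
        in \<open>G\<close>.\<close>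
      also have "\<dots> \<le> (\<Sum>(x, K)\<in>p. e/2 * (Sup K - Inf K) + 
            (if K \<subseteq> G then norm (f (Sup K) - f (Inf K)) else 0))"
      proof (rule sum_norm_le, clarify)
        fix x K assume xK: "(x, K) \<in> p"
        then have "x \<in> K" and kab: "K \<subseteq> {a..b}" using p by blast+
        obtain u v where k: "K = {u..v}" using tagged_division_ofD(4)[OF p xK] unfolding box_real by (elim exE)
        have uv: "u \<le> v" "u \<le> x" "x \<le> v" using \<open>x \<in> K\<close> k by auto
        have S: "Sup K = v" "Inf K = u" using k uv by auto
        have ball: "K \<subseteq> ball x (d x)" using fine xK by blast
        show "norm (measure lborel K *\<^sub>R F x - (f (Sup K) - f (Inf K))) \<le> e/2 * (Sup K - Inf K) + 
            (if K \<subseteq> G then norm (f (Sup K) - f (Inf K)) else 0)"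
        proof (cases "x \<in> E")
          case True
          then have "K \<subseteq> G" using ball d(2) by blast
          then show ?thesis using True e uv by (simp add: F_def S norm_minus_commute)
        next
          case False
          have x: "x \<in> {a..b} - E" using False \<open>x \<in> K\<close> kab by auto
          have "u \<in> K" "v \<in> K" using uv k by auto
          then have 1: "norm (f u - f x - (u - x) *\<^sub>R f' x) \<le> e/2 * norm (u-x)"
            and 2: "norm (f v - f x - (v - x) *\<^sub>R f' x) \<le> e/2 * norm (v-x)"
            using d(3)[OF x] ball kab by (auto simp: dist_norm norm_minus_commute subset_iff)
          have "norm ((v - u) *\<^sub>R f' x - (f v - f u)) = norm (f u - f x - (u - x) *\<^sub>R f' x - (f v - f x - (v - x) *\<^sub>R f' x))"
            by (auto simp: algebra_simps)
          also have "\<dots> \<le> norm (f u - f x - (u - x) *\<^sub>R f' x) + norm (f v - f x - (v - x) *\<^sub>R f' x)"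
            by (rule norm_triangle_ineq4)
          also have "\<dots> \<le> e/2 * (v - u)" using 1 2 uv by (auto simp: algebra_simps)
          finally show ?thesis using False uv k by (simp add: F_def S add_increasing2)
        qed
      qed
      also have "\<dots> = e/2 * (b - a) + (\<Sum>(x, K)\<in>{(x, K) \<in> p. K \<subseteq> G}. norm (f (Sup K) - f (Inf K)))"
      proof -
        have "(\<Sum>(x, K)\<in>p. (if K \<subseteq> G then norm (f (Sup K) - f (Inf K)) else 0)) =
            (\<Sum>(x, K)\<in>{(x, K) \<in> p. K \<subseteq> G}. norm (f (Sup K) - f (Inf K)))"
          using fin by (intro sum.mono_neutral_cong_right) (auto split: if_splits)
        then show ?thesis unfolding ba(1)
          by (simp add: sum.distrib sum_distrib_left case_prod_unfold)
      qed
      also have "\<dots> \<le> e/2 * (b - a) + e1" using Gs[OF p] by simp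
      also have "\<dots> = e * measure lborel {a..b}" using ab by (simp add: e1_def)
      finally show "norm ((\<Sum>(x, k)\<in>p. measure lborel k *\<^sub>R F x) - (f b - f a)) \<le> e * measure lborel {a..b}" .
    qed
  qed
  then show ?thesis
    by (rule has_integral_spike[OF E, rotated]) (auto simp: F_def)
qed

lemma abs_continuous_on_interval_lipschitz:
  fixes f :: "real \<Rightarrow> complex"
  assumes "\<And>x y. x \<in> {a..b} \<Longrightarrow> y \<in> {a..b} \<Longrightarrow> norm (f y - f x) \<le> L * \<bar>y - x\<bar>"
  shows "abs_continuous_on_interval a b f"
  unfolding abs_continuous_on_interval_def
proof (intro allI impI)
  fix e :: real assume e: "e > 0"
  show "\<exists>\<delta>>0. \<forall>D. finite D \<longrightarrow> D \<subseteq> {(x, y). a \<le> x \<and> x \<le> y \<and> y \<le> b} \<longrightarrow>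
        disjoint_family_on (\<lambda>(x, y). {x<..<y}) D \<longrightarrow>
        (\<Sum>(x, y)\<in>D. y - x) < \<delta> \<longrightarrow> (\<Sum>(x, y)\<in>D. norm (f y - f x)) < e"
  \<comment> \<open>The + 1 keeps the denominator positive when L = 0.\<close>
  proof (intro exI[of _ "e / (\<bar>L\<bar> + 1)"] conjI allI impI)
    fix D assume D: "finite D" "D \<subseteq> {(x, y). a \<le> x \<and> x \<le> y \<and> y \<le> b}"
      and s: "(\<Sum>(x, y)\<in>D. y - x) < e / (\<bar>L\<bar> + 1)"
    have "(\<Sum>(x, y)\<in>D. norm (f y - f x)) \<le> (\<Sum>(x, y)\<in>D. (\<bar>L\<bar> + 1) * (y - x))"
    proof (rule sum_mono, clarify)
      fix x y assume "(x, y) \<in> D"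
      then have xy: "a \<le> x" "x \<le> y" "y \<le> b" using D by auto
      then have "norm (f y - f x) \<le> L * (y - x)" using assms[of x y] by auto
      also have "\<dots> \<le> (\<bar>L\<bar> + 1) * (y - x)" using xy by (intro mult_right_mono) auto
      finally show "norm (f y - f x) \<le> (\<bar>L\<bar> + 1) * (y - x)" .
    qed
    also have "\<dots> = (\<bar>L\<bar> + 1) * (\<Sum>(x, y)\<in>D. y - x)" by (simp add: sum_distrib_left case_prod_unfold)
    also have "\<dots> < (\<bar>L\<bar> + 1) * (e / (\<bar>L\<bar> + 1))" using s by (intro mult_strict_left_mono) auto
    finally show "(\<Sum>(x, y)\<in>D. norm (f y - f x)) < e" by simp
  qed (use e in auto)
qed

text \<open>Sums and products of absolutely continuous functions are both instances of an increment
  bound by the increments of two absolutely continuous functions.\<close>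

lemma abs_continuous_on_interval_dominated:
  fixes f g h :: "real \<Rightarrow> complex"
  assumes f: "abs_continuous_on_interval a b f" and g: "abs_continuous_on_interval a b g"
    and h: "\<And>x y. x \<in> {a..b} \<Longrightarrow> y \<in> {a..b} \<Longrightarrow> norm (h y - h x) \<le> A * norm (f y - f x) + B * norm (g y - g x)"
  shows "abs_continuous_on_interval a b h"
  unfolding abs_continuous_on_interval_def
proof (intro allI impI)
  fix e :: real assume e: "e > 0"
  define C where "C = \<bar>A\<bar> + \<bar>B\<bar> + 1"
  have C: "C > 0" "A \<le> C" "B \<le> C" by (auto simp: C_def)
  have e2: "e / (2 * C) > 0" using e C by simp
  obtain d1 where d1: "d1 > 0" 
    "\<And>D. finite D \<Longrightarrow> D \<subseteq> {(x, y). a \<le> x \<and> x \<le> y \<and> y \<le> b} \<Longrightarrow>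
        disjoint_family_on (\<lambda>(x, y). {x<..<y}) D \<Longrightarrow>
        (\<Sum>(x, y)\<in>D. y - x) < d1 \<Longrightarrow> (\<Sum>(x, y)\<in>D. norm (f y - f x)) < e / (2 * C)"
    using abs_continuous_on_intervalD[OF f e2] by blast
  obtain d2 where d2: "d2 > 0" 
    "\<And>D. finite D \<Longrightarrow> D \<subseteq> {(x, y). a \<le> x \<and> x \<le> y \<and> y \<le> b} \<Longrightarrow>
        disjoint_family_on (\<lambda>(x, y). {x<..<y}) D \<Longrightarrow>
        (\<Sum>(x, y)\<in>D. y - x) < d2 \<Longrightarrow> (\<Sum>(x, y)\<in>D. norm (g y - g x)) < e / (2 * C)"
    using abs_continuous_on_intervalD[OF g e2] by blast
  show "\<exists>\<delta>>0. \<forall>D. finite D \<longrightarrow> D \<subseteq> {(x, y). a \<le> x \<and> x \<le> y \<and> y \<le> b} \<longrightarrow>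
        disjoint_family_on (\<lambda>(x, y). {x<..<y}) D \<longrightarrow>
        (\<Sum>(x, y)\<in>D. y - x) < \<delta> \<longrightarrow> (\<Sum>(x, y)\<in>D. norm (h y - h x)) < e"
  proof (intro exI[of _ "min d1 d2"] conjI allI impI)
    fix D assume D: "finite D" "D \<subseteq> {(x, y). a \<le> x \<and> x \<le> y \<and> y \<le> b}"
      "disjoint_family_on (\<lambda>(x, y). {x<..<y}) D"
      and s: "(\<Sum>(x, y)\<in>D. y - x) < min d1 d2"
    have "(\<Sum>(x, y)\<in>D. norm (h y - h x)) \<le> (\<Sum>(x, y)\<in>D. C * norm (f y - f x) + C * norm (g y - g x))"
    proof (rule sum_mono, clarify)
      fix x y assume "(x, y) \<in> D"
      then have xy: "a \<le> x" "x \<le> y" "y \<le> b" using D by auto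
      then have "norm (h y - h x) \<le> A * norm (f y - f x) + B * norm (g y - g x)" using h[of x y] by auto
      also have "\<dots> \<le> C * norm (f y - f x) + C * norm (g y - g x)"
        using C by (intro add_mono mult_right_mono) auto
      finally show "norm (h y - h x) \<le> C * norm (f y - f x) + C * norm (g y - g x)" .
    qed
    also have "\<dots> = C * (\<Sum>(x, y)\<in>D. norm (f y - f x)) + C * (\<Sum>(x, y)\<in>D. norm (g y - g x))" 
      by (simp add: sum_distrib_left case_prod_unfold sum.distrib)
    also have "\<dots> < C * (e / (2 * C)) + C * (e / (2 * C))" using d1(2)[OF D] d2(2)[OF D] s C
      by (intro add_strict_mono mult_strict_left_mono) auto
    also have "\<dots> = e" using C by (simp add: field_simps)
    finally show "(\<Sum>(x, y)\<in>D. norm (h y - h x)) < e" .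
  qed (use d1 d2 in auto)
qed

lemma abs_continuous_on_interval_add:
  assumes "abs_continuous_on_interval a b f" "abs_continuous_on_interval a b g"
  shows "abs_continuous_on_interval a b (\<lambda>x. f x + g x)"
proof (rule abs_continuous_on_interval_dominated[OF assms, where A = 1 and B = 1])
  fix x y
  have "f y + g y - (f x + g x) = (f y - f x) + (g y - g x)" by simp
  then show "norm (f y + g y - (f x + g x)) \<le> 1 * norm (f y - f x) + 1 * norm (g y - g x)"
    using norm_triangle_ineq[of "f y - f x" "g y - g x"] by (simp add: algebra_simps)
qed

lemma abs_continuous_on_interval_sum:
  assumes "\<And>i. i \<in> I \<Longrightarrow> abs_continuous_on_interval a b (f i)"
  shows "abs_continuous_on_interval a b (\<lambda>x. \<Sum>i\<in>I. f i x)"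
proof (cases "finite I")
  case True
  then show ?thesis using assms
    by (induction I) (auto intro: abs_continuous_on_interval_add abs_continuous_on_interval_lipschitz[where L = 0])
qed (auto intro: abs_continuous_on_interval_lipschitz[where L = 0])

lemma abs_continuous_on_interval_mult:
  assumes "abs_continuous_on_interval a b f" "abs_continuous_on_interval a b g"
    and cf: "continuous_on {a..b} f" and cg: "continuous_on {a..b} g"
  shows "abs_continuous_on_interval a b (\<lambda>x. f x * g x)"
proof -
  have "bounded (f ` {a..b})" "bounded (g ` {a..b})"
    using cf cg by (auto intro!: compact_imp_bounded compact_continuous_image)
  then obtain A B where A: "\<And>x. x \<in> {a..b} \<Longrightarrow> norm (f x) \<le> A" and B: "\<And>x. x \<in> {a..b} \<Longrightarrow> norm (g x) \<le> B"
    unfolding bounded_iff by fastforce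
  show ?thesis
  proof (rule abs_continuous_on_interval_dominated[OF assms(1,2)])
    fix x y assume xy: "x \<in> {a..b}" "y \<in> {a..b}"
    have "f y * g y - f x * g x = (f y - f x) * g y + f x * (g y - g x)" by (simp add: algebra_simps)
    then have "norm (f y * g y - f x * g x) \<le> norm (f y - f x) * norm (g y) + norm (f x) * norm (g y - g x)"
      using norm_triangle_ineq[of "(f y - f x) * g y" "f x * (g y - g x)"] by (simp add: norm_mult)
    also have "\<dots> \<le> norm (f y - f x) * B + A * norm (g y - g x)"
      using A B xy by (intro add_mono mult_mono) (auto intro: order_trans[OF norm_ge_zero])
    finally show "norm (f y * g y - f x * g x) \<le> B * norm (f y - f x) + A * norm (g y - g x)"
      by (simp add: mult.commute)
  qed
qed

lemma abs_continuous_on_interval_C1: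
  fixes f :: "real \<Rightarrow> complex"
  assumes "\<And>x. (f has_vector_derivative f' x) (at x)" "continuous_on {a..b} f'"
  shows "abs_continuous_on_interval a b f"
proof -
  have "bounded (f' ` {a..b})" using assms(2) by (auto intro!: compact_imp_bounded compact_continuous_image)
  then obtain L where L: "\<And>x. x \<in> {a..b} \<Longrightarrow> norm (f' x) \<le> L"
    unfolding bounded_iff by fastforce
  show ?thesis
  proof (rule abs_continuous_on_interval_lipschitz)
    fix x y assume xy: "x \<in> {a..b}" "y \<in> {a..b}"
    have "norm (f y - f x) \<le> L * norm (y - x)"
    proof (rule differentiable_bound[where S = "{a..b}" and f' = "\<lambda>x t. t *\<^sub>R f' x"])
      fix x assume "x \<in> {a..b}"
      then show "(f has_derivative (\<lambda>t. t *\<^sub>R f' x)) (at x within {a..b})"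
        using assms(1) by (simp add: has_vector_derivative_def has_derivative_at_withinI)
      show "onorm (\<lambda>t. t *\<^sub>R f' x) \<le> L" using L[OF \<open>x \<in> {a..b}\<close>]
        by (intro onorm_le) (simp add: mult.commute[of L] mult_left_mono)
    qed (use xy in auto)
    then show "norm (f y - f x) \<le> L * \<bar>y - x\<bar>" by simp
  qed
qed

subsection \<open>Fourier coefficients on the circle\<close>

lemma space_circle_measure [simp]: "space circle_measure = sphere 0 1"
  by (simp add: circle_measure_def)

lemma sets_circle_measure: "sets circle_measure = sets (restrict_space borel (sphere 0 1))"
  by (simp add: circle_measure_def)

lemma measurable_cis_sphere: "cis \<in> measurable (uniform_measure lborel A) (restrict_space borel (sphere 0 1))"
proof -
  have "cis \<in> borel_measurable borel" by (intro borel_measurable_continuous_onI continuous_intros)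
  then have "cis \<in> measurable borel (restrict_space borel (sphere 0 1))"
    by (intro measurable_restrict_space2) auto
  then show ?thesis by (subst measurable_cong_sets[where M' = borel]) auto
qed

lemma prob_space_circle_measure: "prob_space circle_measure"
  unfolding circle_measure_def
  by (intro prob_space.prob_space_distr prob_space_uniform_measure measurable_cis_sphere) auto

lemma AE_circle_measureD:
  assumes "AE z in circle_measure. P z"
  shows "AE t in lborel. t \<in> {0..2 * pi} \<longrightarrow> P (cis t)"
proof -
  have "AE t in uniform_measure lborel {0..2 * pi}. P (cis t)"
    using assms unfolding circle_measure_def by (rule AE_distrD[OF measurable_cis_sphere])
  then show ?thesis by (subst (asm) AE_uniform_measure) auto
qed

lemma borel_measurable_circle_measure:
  "continuous_on (sphere 0 1) f \<Longrightarrow> f \<in> borel_measurable circle_measure"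
  using borel_measurable_continuous_on_restrict measurable_cong_sets[OF sets_circle_measure refl] by blast

lemma borel_measurable_indicator_circle:
  fixes B :: "complex set"
  assumes "B \<in> sets borel"
  shows "(indicator B :: complex \<Rightarrow> 'a :: real_normed_field) \<in> borel_measurable circle_measure"
proof -
  have "(indicator B :: complex \<Rightarrow> 'a) \<in> borel_measurable borel"
    using assms by (rule borel_measurable_indicator)
  then show ?thesis
    by (subst measurable_cong_sets[OF sets_circle_measure refl]) (rule measurable_restrict_space1)
qed

lemma integrable_circle_mult:
  fixes p h :: "complex \<Rightarrow> complex"
  assumes p: "continuous_on (sphere 0 1) p" and h: "integrable circle_measure h"
  shows "integrable circle_measure (\<lambda>z. p z * h z)"
proof -
  have "bounded (p ` sphere 0 1)" using p by (intro compact_imp_bounded compact_continuous_image) auto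
  then obtain B where B: "\<And>z. z \<in> sphere 0 1 \<Longrightarrow> norm (p z) \<le> B" unfolding bounded_iff by fastforce
  note [measurable] = borel_measurable_circle_measure[OF p] borel_measurable_integrable[OF h]
  show ?thesis
  proof (rule Bochner_Integration.integrable_bound)
    show "integrable circle_measure (\<lambda>z. B * norm (h z))" using h by simp
    show "AE z in circle_measure. norm (p z * h z) \<le> norm (B * norm (h z))"
    proof (rule AE_I2)
      fix z assume "z \<in> space circle_measure"
      then have "norm (p z) \<le> \<bar>B\<bar>" using B[of z] by auto
      then show "norm (p z * h z) \<le> norm (B * norm (h z))"
        by (simp add: norm_mult abs_mult mult_right_mono)
    qed
  qed simp
qed

lemma continuous_on_powi_sphere: "continuous_on (sphere 0 1) (\<lambda>z::complex. z powi s)"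
  by (intro continuous_on_power_int continuous_on_id) auto

lemma integrable_powi_mult:
  "integrable circle_measure h \<Longrightarrow> integrable circle_measure (\<lambda>z. z powi s * h z)"
  by (rule integrable_circle_mult[OF continuous_on_powi_sphere])

lemma integral_circle_measure:
  fixes f :: "complex \<Rightarrow> complex"
  assumes f: "integrable circle_measure f"
  shows "set_integrable lborel {0..2 * pi} (\<lambda>t. f (cis t))"
    and "(\<integral>z. f z \<partial>circle_measure) = (\<integral>t\<in>{0..2 * pi}. f (cis t) \<partial>lborel) / (2 * pi)"
proof -
  have uni: "uniform_measure lborel {0..2 * pi} = density lborel (\<lambda>t. ennreal (indicator {0..2 * pi} t / (2 * pi)))"
    unfolding uniform_measure_def
    by (intro arg_cong2[of _ _ _ _ density] refl ext) (auto simp: indicator_def divide_ennreal[symmetric] ennreal_1)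
  have 1: "integrable (uniform_measure lborel {0..2 * pi}) (\<lambda>t. f (cis t))"
    and 2: "(\<integral>z. f z \<partial>circle_measure) = (\<integral>t. f (cis t) \<partial>uniform_measure lborel {0..2 * pi})"
  proof -
    have "f \<in> borel_measurable (restrict_space borel (sphere 0 1))"
      using borel_measurable_integrable[OF f] measurable_cong_sets[OF sets_circle_measure refl] by blast
    note m = this
    show "integrable (uniform_measure lborel {0..2 * pi}) (\<lambda>t. f (cis t))"
      using f integrable_distr_eq[OF measurable_cis_sphere m] unfolding circle_measure_def by blast
    show "(\<integral>z. f z \<partial>circle_measure) = (\<integral>t. f (cis t) \<partial>uniform_measure lborel {0..2 * pi})"
      unfolding circle_measure_def by (rule integral_distr[OF measurable_cis_sphere m])
  qed
  have m: "(\<lambda>t. f (cis t)) \<in> borel_measurable lborel"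
    using borel_measurable_integrable[OF 1] by (simp add: measurable_cong_sets[OF sets_uniform_measure refl])
  have "integrable lborel (\<lambda>t. (indicator {0..2 * pi} t / (2 * pi)) *\<^sub>R f (cis t))"
    using 1 m unfolding uni by (subst (asm) integrable_density) auto
  then have "integrable lborel (\<lambda>t. (2 * pi) *\<^sub>R ((indicator {0..2 * pi} t / (2 * pi)) *\<^sub>R f (cis t)))"
    by (rule integrable_scaleR_right)
  then show "set_integrable lborel {0..2 * pi} (\<lambda>t. f (cis t))"
    unfolding set_integrable_def by simp
  have "(\<integral>z. f z \<partial>circle_measure) = (\<integral>t. (indicator {0..2 * pi} t / (2 * pi)) *\<^sub>R f (cis t) \<partial>lborel)"
    unfolding 2 uni using m by (subst integral_density) auto
  also have "\<dots> = (\<integral>t. (1 / (2 * pi)) *\<^sub>R (indicator {0..2 * pi} t *\<^sub>R f (cis t)) \<partial>lborel)"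
    by (intro Bochner_Integration.integral_cong) auto
  also have "\<dots> = (\<integral>t\<in>{0..2 * pi}. f (cis t) \<partial>lborel) / (2 * pi)"
    unfolding set_lebesgue_integral_def by (subst integral_scaleR_right) (auto simp: scaleR_conv_of_real field_simps)
  finally show "(\<integral>z. f z \<partial>circle_measure) = (\<integral>t\<in>{0..2 * pi}. f (cis t) \<partial>lborel) / (2 * pi)" .
qed

text \<open>\<open>circle_measure\<close> has no atoms: the angles of a given point form at most one
  coset of the multiples of 2 pi, a countable set.\<close>

lemma AE_circle_measure_neq: "AE z in circle_measure. z \<noteq> c"
proof -
  have "countable {t. cis t = c}"
  proof (cases "\<exists>a. cis a = c")
    case True
    then obtain a where a: "cis a = c" by blast
    have "{t. cis t = c} \<subseteq> range (\<lambda>n::int. a + 2 * pi * n)"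
      using sin_cos_eq_iff[of _ a] a by (auto simp: cis.ctr complex_eq_iff)
    then show ?thesis by (rule countable_subset) auto
  qed auto
  then have "AE t in lborel. t \<notin> {t. cis t = c}"
    by (intro AE_not_in countable_imp_null_set_lborel)
  then have "AE t in uniform_measure lborel {0..2 * pi}. cis t \<noteq> c"
    by (intro AE_uniform_measureI) (auto elim: eventually_mono)
  moreover have "{z \<in> sphere 0 1. z \<noteq> c} \<in> sets (restrict_space borel (sphere 0 1))"
    by (auto simp: sets_restrict_space intro!: image_eqI[of _ _ "- {c}"])
  ultimately show ?thesis unfolding circle_measure_def
    by (subst AE_distr_iff[OF measurable_cis_sphere]) (auto simp: space_restrict_space)
qed

section \<open>Uniqueness of Fourier series for integrable functions on the circle\<close>

text \<open>On the circle conjugation is inversion, so a real linear form is a combination of z and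
  1/z, and multiplying by it only shifts frequencies. The induction generalises over
  \<open>h\<close> because the product case applies the hypothesis for one factor to the other
  factor times \<open>h\<close>.\<close>

lemma laurent_coeff_polynomial_mult_eq_0:
  assumes "real_polynomial_function p" "integrable circle_measure h" "\<And>s. laurent_coeff h s = 0"
  shows "laurent_coeff (\<lambda>z. of_real (p z) * h z) s = 0"
  using assms
proof (induction p arbitrary: h s rule: real_polynomial_function.induct)
  case (linear l)
  \<comment> \<open>From l(z) = Re z * l(1) + Im z * l(i), with Re z = (z + 1/z) / 2 and Im z = (z -
    1/z) / (2i) on the circle.\<close>
  define \<alpha> \<beta> where "\<alpha> = (of_real (l 1) - \<i> * of_real (l \<i>)) / 2" and "\<beta> = (of_real (l 1) + \<i> * of_real (l \<i>)) / 2"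
  have *: "z powi s * (of_real (l z) * h z) = \<alpha> * (z powi (s + 1) * h z) + \<beta> * (z powi (s - 1) * h z)"
    if z: "z \<in> sphere 0 1" for z
  proof -
    have z0: "z \<noteq> 0" using z by auto
    have "z * cnj z = 1" using z by (simp add: complex_norm_square[symmetric])
    then have inv: "inverse z = cnj z" using z0 by (simp add: field_simps)
    have "z = Re z *\<^sub>R 1 + Im z *\<^sub>R \<i>" by (simp add: complex_eq_iff)
    then have "l z = l (Re z *\<^sub>R 1 + Im z *\<^sub>R \<i>)" by (rule arg_cong)
    also have "\<dots> = Re z * l 1 + Im z * l \<i>"
      using linear(1) by (simp add: linear_add linear_scale bounded_linear.linear)
    finally have "complex_of_real (l z) = \<alpha> * z + \<beta> * cnj z"
      by (simp add: \<alpha>_def \<beta>_def complex_eq_iff field_simps)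
    then have "z powi s * (of_real (l z) * h z) = \<alpha> * (z powi s * z * h z) + \<beta> * (z powi s * inverse z * h z)"
      by (simp add: inv algebra_simps)
    then show ?thesis using z0 by (simp add: power_int_add power_int_diff field_simps)
  qed
  have "laurent_coeff (\<lambda>z. of_real (l z) * h z) s =
    (\<integral>z. \<alpha> * (z powi (s + 1) * h z) + \<beta> * (z powi (s - 1) * h z) \<partial>circle_measure)"
    unfolding laurent_coeff_def by (intro Bochner_Integration.integral_cong) (auto simp: *)
  also have "\<dots> = \<alpha> * laurent_coeff h (s + 1) + \<beta> * laurent_coeff h (s - 1)"
    unfolding laurent_coeff_def using linear(2)
    by (subst Bochner_Integration.integral_add) (auto intro!: integrable_mult_right integrable_powi_mult)
  finally show ?case using linear(3) by simp
next
  case (const c)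
  have "laurent_coeff (\<lambda>z. of_real c * h z) s = (\<integral>z. of_real c * (z powi s * h z) \<partial>circle_measure)"
    unfolding laurent_coeff_def by (simp add: ac_simps)
  also have "\<dots> = of_real c * laurent_coeff h s" unfolding laurent_coeff_def by simp
  finally show ?case using const by simp
next
  case (add f g)
  have c: "continuous_on (sphere 0 1) (\<lambda>z. complex_of_real (q z))" if "real_polynomial_function q" for q :: "complex \<Rightarrow> real"
    using that continuous_on_polymonial_function real_polynomial_function_eq by (metis continuous_on_of_real)
  have "laurent_coeff (\<lambda>z. of_real (f z + g z) * h z) s =
    (\<integral>z. z powi s * (of_real (f z) * h z) + z powi s * (of_real (g z) * h z) \<partial>circle_measure)"
    unfolding laurent_coeff_def by (simp add: algebra_simps)
  also have "\<dots> = laurent_coeff (\<lambda>z. of_real (f z) * h z) s + laurent_coeff (\<lambda>z. of_real (g z) * h z) s"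
    unfolding laurent_coeff_def using add c
    by (subst Bochner_Integration.integral_add) (auto intro!: integrable_powi_mult integrable_circle_mult)
  finally show ?case using add by simp
next
  case (mult f g)
  have "continuous_on (sphere 0 1) (\<lambda>z. complex_of_real (g z))"
    using mult(2) continuous_on_polymonial_function real_polynomial_function_eq by (metis continuous_on_of_real)
  then have "integrable circle_measure (\<lambda>z. of_real (g z) * h z)" using mult by (intro integrable_circle_mult)
  then have "laurent_coeff (\<lambda>z. of_real (f z) * (of_real (g z) * h z)) s = 0"
    using mult by auto
  then show ?case by (simp add: mult.assoc)
qed

text \<open>Stone-Weierstrass with real polynomials in the two coordinates of z, which take the
  place of trigonometric polynomials. A uniform error changes the integral by at most that error
  times the L1 norm of \<open>h\<close>.\<close>

lemma integral_continuous_mult_eq_0: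
  fixes \<phi> :: "complex \<Rightarrow> real"
  assumes h: "integrable circle_measure h" and z: "\<And>s. laurent_coeff h s = 0"
    and \<phi>: "continuous_on (sphere 0 1) \<phi>"
  shows "(\<integral>z. of_real (\<phi> z) * h z \<partial>circle_measure) = 0"
proof -
  define I where "I = (\<integral>z. norm (h z) \<partial>circle_measure)"
  have I0: "I \<ge> 0" by (simp add: I_def)
  have "norm (\<integral>z. of_real (\<phi> z) * h z \<partial>circle_measure) \<le> e" if e: "e > 0" for e
  proof -
    \<comment> \<open>The + 1 covers the case I = 0.\<close>
    have "e / (I + 1) > 0" using e I0 by simp
    then obtain p where p: "real_polynomial_function p" "\<And>z. z \<in> sphere 0 1 \<Longrightarrow> \<bar>\<phi> z - p z\<bar> < e / (I + 1)"
      using Stone_Weierstrass_real_polynomial_function[OF _ \<phi>] by (metis compact_sphere)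
    have cp: "continuous_on (sphere 0 1) p"
      using p(1) continuous_on_polymonial_function real_polynomial_function_eq by metis
    have ip: "integrable circle_measure (\<lambda>z. of_real (p z) * h z)"
      and i\<phi>: "integrable circle_measure (\<lambda>z. of_real (\<phi> z) * h z)"
      using h cp \<phi> by (auto intro!: integrable_circle_mult continuous_intros)
    have p0: "(\<integral>z. of_real (p z) * h z \<partial>circle_measure) = 0"
      using laurent_coeff_polynomial_mult_eq_0[OF p(1) h z, of 0] by (simp add: laurent_coeff_def)
    have "norm (\<integral>z. of_real (\<phi> z) * h z \<partial>circle_measure) = norm (\<integral>z. of_real (\<phi> z) * h z - of_real (p z) * h z \<partial>circle_measure)"
      by (subst Bochner_Integration.integral_diff[OF i\<phi> ip]) (simp add: p0)
    also have "\<dots> \<le> (\<integral>z. e / (I + 1) * norm (h z) \<partial>circle_measure)"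
    proof (rule Bochner_Integration.integral_norm_bound_integral)
      fix z assume "z \<in> space circle_measure"
      then have "\<bar>\<phi> z - p z\<bar> \<le> e / (I + 1)" using p(2)[of z] by auto
      then have "\<bar>\<phi> z - p z\<bar> * norm (h z) \<le> e / (I + 1) * norm (h z)" by (rule mult_right_mono) simp
      then show "norm (of_real (\<phi> z) * h z - of_real (p z) * h z) \<le> e / (I + 1) * norm (h z)"
        by (metis left_diff_distrib norm_mult norm_of_real of_real_diff)
    qed (use ip i\<phi> h in auto)
    also have "\<dots> = e / (I + 1) * I" by (simp add: I_def)
    also have "\<dots> \<le> e" using e I0 by (simp add: field_simps)
    finally show ?thesis .
  qed
  then have "norm (\<integral>z. of_real (\<phi> z) * h z \<partial>circle_measure) \<le> 0"
    by (rule field_le_epsilon) simp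
  then show ?thesis by simp
qed

text \<open>The indicator of a closed set is the pointwise limit of continuous functions that fall
  from 1 to 0 within distance 1/n of the set; dominated convergence with bound |h| does the
  rest.\<close>

lemma integral_closed_indicator_eq_0:
  assumes h: "integrable circle_measure h" and z: "\<And>s. laurent_coeff h s = 0" and A: "closed A"
  shows "(\<integral>z. indicator A z * h z \<partial>circle_measure) = 0"
\<comment> \<open>\<open>infdist\<close> to the empty set is 0 by convention, so the approximating
  functions would tend to 1 instead of 0.\<close>
proof (cases "A = {}")
  case False
  define \<phi> where "\<phi> = (\<lambda>n z. max 0 (1 - real n * infdist z A))"
  have c: "continuous_on (sphere 0 1) (\<phi> n)" for n
    unfolding \<phi>_def by (intro continuous_intros)
  have [measurable]: "h \<in> borel_measurable circle_measure" using h by simp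
  have [measurable]: "A \<in> sets borel" using A by simp
  have ind: "(indicator A :: complex \<Rightarrow> complex) \<in> borel_measurable circle_measure"
    by (rule borel_measurable_indicator_circle) simp
  have "(\<lambda>n. \<integral>z. of_real (\<phi> n z) * h z \<partial>circle_measure) \<longlonglongrightarrow> (\<integral>z. indicator A z * h z \<partial>circle_measure)"
  proof (rule integral_dominated_convergence)
    show "(\<lambda>z. indicator A z * h z) \<in> borel_measurable circle_measure" using ind by measurable
    show "(\<lambda>z. complex_of_real (\<phi> n z) * h z) \<in> borel_measurable circle_measure" for n
      using borel_measurable_circle_measure[OF c[of n]] by measurable
    show "integrable circle_measure (\<lambda>z. norm (h z))" using h by simp
    show "AE x in circle_measure. norm (of_real (\<phi> n x) * h x) \<le> norm (h x)" for n
    proof (rule AE_I2)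
      fix x
      have "\<bar>\<phi> n x\<bar> \<le> 1" using infdist_nonneg[of x A] by (auto simp: \<phi>_def)
      then show "norm (of_real (\<phi> n x) * h x) \<le> norm (h x)" 
        by (simp add: norm_mult mult_left_le_one_le)
    qed
    show "AE x in circle_measure. (\<lambda>n. of_real (\<phi> n x) * h x) \<longlonglongrightarrow> indicator A x * h x"
    proof (rule AE_I2)
      fix x
      have "(\<lambda>n. \<phi> n x) \<longlonglongrightarrow> indicator A x"
      proof (cases "x \<in> A")
        case True
        then show ?thesis by (simp add: \<phi>_def)
      next
        case F2: False
        then have d: "infdist x A > 0" using A False in_closed_iff_infdist_zero infdist_nonneg
          by (metis order_le_less)
        have "eventually (\<lambda>n. \<phi> n x = 0) sequentially"
          using eventually_ge_at_top[of "nat \<lceil>1 / infdist x A\<rceil>"]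
        proof eventually_elim
          case (elim n)
          then have "1 / infdist x A \<le> real n" by linarith
          then show ?case using d by (simp add: \<phi>_def field_simps)
        qed
        then show ?thesis using F2 by (simp add: tendsto_eventually)
      qed
      then have "(\<lambda>n. complex_of_real (\<phi> n x)) \<longlonglongrightarrow> of_real (indicator A x)" by (rule tendsto_of_real)
      then have "(\<lambda>n. complex_of_real (\<phi> n x)) \<longlonglongrightarrow> indicator A x"
        by (cases "x \<in> A") simp_all
      then show "(\<lambda>n. of_real (\<phi> n x) * h x) \<longlonglongrightarrow> indicator A x * h x"
        by (intro tendsto_mult tendsto_const)
    qed
  qed
  then have "(\<lambda>n. 0) \<longlonglongrightarrow> (\<integral>z. indicator A z * h z \<partial>circle_measure)"
    by (simp only: integral_continuous_mult_eq_0[OF h z c])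
  then show ?thesis by (rule LIMSEQ_unique[OF _ tendsto_const])
qed simp

text \<open>Dynkin's argument: closed sets generate the Borel sets and are stable under
  intersection. Complements work because the coefficient of index 0 is the integral over the whole
  circle, disjoint unions by dominated convergence.\<close>

lemma integral_borel_indicator_eq_0:
  assumes h: "integrable circle_measure h" and z: "\<And>s. laurent_coeff h s = 0" and A: "A \<in> sets borel"
  shows "(\<integral>z. indicator A z * h z \<partial>circle_measure) = 0"
proof -
  have [measurable]: "h \<in> borel_measurable circle_measure" using h by simp
  note ind = borel_measurable_indicator_circle[where 'a = complex]
  have int: "integrable circle_measure (\<lambda>z. indicator B z * h z)" if "B \<in> sets borel" for B :: "complex set"
  proof (rule Bochner_Integration.integrable_bound[OF h])
    show "(\<lambda>z. indicator B z * h z) \<in> borel_measurable circle_measure" using ind[OF that] by measurable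
  qed (auto simp: indicator_def)
  have sig: "sets borel = sigma_sets UNIV (Collect closed :: complex set set)"
    by (subst borel_eq_closed) simp
  have "Int_stable (Collect closed :: complex set set)" by (auto simp: Int_stable_def)
  moreover have "Collect closed \<subseteq> Pow (UNIV :: complex set)" by simp
  ultimately show ?thesis
    using A[unfolded sig]
  proof (induction rule: sigma_sets_induct_disjoint)
    case (basic A)
    then show ?case using integral_closed_indicator_eq_0[OF h z] by simp
  next
    case empty
    show ?case by simp
  next
    case (compl A)
    then have A: "A \<in> sets borel" by (simp add: sig)
    have "(\<integral>z. indicator (UNIV - A) z * h z \<partial>circle_measure) = (\<integral>z. h z - indicator A z * h z \<partial>circle_measure)"
      by (intro Bochner_Integration.integral_cong) (auto simp: indicator_def)
    also have "\<dots> = (\<integral>z. h z \<partial>circle_measure)"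
      using compl(2) int[OF A] h by simp
    also have "\<dots> = 0" using z[of 0] by (simp add: laurent_coeff_def)
    finally show ?case .
  next
    case (union A)
    have A: "A i \<in> sets borel" for i using union(2) by (auto simp: sig)
    \<comment> \<open>By disjointness each partial sum is \<open>h\<close> restricted to a finite
      union, so |h| dominates all of them.\<close>
    have "(\<lambda>n. \<integral>z. (\<Sum>i<n. indicator (A i) z * h z) \<partial>circle_measure) \<longlonglongrightarrow> (\<integral>z. indicator (\<Union>i. A i) z * h z \<partial>circle_measure)"
    proof (rule integral_dominated_convergence)
      have U: "(\<Union>i. A i) \<in> sets borel" using A by blast
      show "(\<lambda>z. indicator (\<Union>i. A i) z * h z) \<in> borel_measurable circle_measure" using ind[OF U] by measurable
      show "(\<lambda>z. \<Sum>i<n. indicator (A i) z * h z) \<in> borel_measurable circle_measure" for n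
        using int[OF A] by (intro borel_measurable_sum) simp
      show "integrable circle_measure (\<lambda>z. norm (h z))" using h by simp
      show "AE x in circle_measure. norm (\<Sum>i<n. indicator (A i) x * h x) \<le> norm (h x)" for n
      proof (rule AE_I2)
        fix x
        have "disjoint_family_on A {..<n}" using union(1) by (auto simp: disjoint_family_on_def)
        then have "(\<Sum>i<n. indicator (A i) x * h x) = indicator (\<Union>i<n. A i) x * h x"
          by (simp add: indicator_UN_disjoint sum_distrib_right)
        moreover have "norm (indicator B x * h x) \<le> norm (h x)" for B
          by (simp add: indicator_def)
        ultimately show "norm (\<Sum>i<n. indicator (A i) x * h x) \<le> norm (h x)"
          by (simp only:)
      qed
      show "AE x in circle_measure. (\<lambda>n. \<Sum>i<n. indicator (A i) x * h x) \<longlonglongrightarrow> indicator (\<Union>i. A i) x * h x"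
      proof (rule AE_I2)
        fix x
        have *: "(\<Sum>i<n. indicator (A i) x * h x) = indicator (\<Union>i<n. A i) x * h x" for n
        proof -
          have "disjoint_family_on A {..<n}" using union(1) by (auto simp: disjoint_family_on_def)
          then show ?thesis by (simp add: indicator_UN_disjoint sum_distrib_right)
        qed
        have "(\<lambda>n. indicator (\<Union>i<n. A i) x * h x) \<longlonglongrightarrow> indicator (\<Union>i. A i) x * h x"
          by (intro tendsto_mult tendsto_const LIMSEQ_indicator_UN)
        then show "(\<lambda>n. \<Sum>i<n. indicator (A i) x * h x) \<longlonglongrightarrow> indicator (\<Union>i. A i) x * h x"
          unfolding * .
      qed
    qed
    moreover have "(\<integral>z. (\<Sum>i<n. indicator (A i) z * h z) \<partial>circle_measure) = 0" for n
      by (subst Bochner_Integration.integral_sum) (use int[OF A] union(3) in simp_all)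
    ultimately have "(\<lambda>n. 0) \<longlonglongrightarrow> (\<integral>z. indicator (\<Union>i. A i) z * h z \<partial>circle_measure)"
      by (simp only:)
    then show ?case by (rule LIMSEQ_unique[OF _ tendsto_const])
  qed
qed

text \<open>The integral of \<open>h\<close> over every measurable set vanishes. The real and
  imaginary parts are treated separately, since \<open>density_unique_real\<close> concerns real
  functions.\<close>

lemma laurent_coeff_eq_0_imp_AE_0:
  assumes h: "integrable circle_measure h" and z: "\<And>s. laurent_coeff h s = 0"
  shows "AE z in circle_measure. h z = 0"
proof -
  have 0: "(\<integral>z. indicator A z * h z \<partial>circle_measure) = 0" and 
    1: "integrable circle_measure (\<lambda>z. indicator A z * h z)" if "A \<in> sets circle_measure" for A
  proof -
    have "A \<in> sets borel" using that by (auto simp: sets_circle_measure sets_restrict_space)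
    then show "(\<integral>z. indicator A z * h z \<partial>circle_measure) = 0" by (rule integral_borel_indicator_eq_0[OF h z])
    show "integrable circle_measure (\<lambda>z. indicator A z * h z)"
      by (rule Bochner_Integration.integrable_bound[OF h]) (use that h in \<open>auto simp: indicator_def\<close>)
  qed
  have "AE z in circle_measure. Re (h z) = 0"
  proof (rule density_unique_real)
    fix A assume A: "A \<in> sets circle_measure"
    have "(\<integral>x\<in>A. Re (h x) \<partial>circle_measure) = (\<integral>x. Re (indicator A x * h x) \<partial>circle_measure)"
      unfolding set_lebesgue_integral_def by (intro Bochner_Integration.integral_cong) (auto simp: indicator_def)
    also have "\<dots> = 0" using 0[OF A] integral_Re[OF 1[OF A]] by simp
    finally show "(\<integral>x\<in>A. Re (h x) \<partial>circle_measure) = (\<integral>x\<in>A. 0 \<partial>circle_measure)" by simp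
  qed (use h in auto)
  moreover have "AE z in circle_measure. Im (h z) = 0"
  proof (rule density_unique_real)
    fix A assume A: "A \<in> sets circle_measure"
    have "(\<integral>x\<in>A. Im (h x) \<partial>circle_measure) = (\<integral>x. Im (indicator A x * h x) \<partial>circle_measure)"
      unfolding set_lebesgue_integral_def by (intro Bochner_Integration.integral_cong) (auto simp: indicator_def)
    also have "\<dots> = 0" using 0[OF A] integral_Im[OF 1[OF A]] by simp
    finally show "(\<integral>x\<in>A. Im (h x) \<partial>circle_measure) = (\<integral>x\<in>A. 0 \<partial>circle_measure)" by simp
  qed (use h in auto)
  ultimately show ?thesis by eventually_elim (simp add: complex_eq_iff)
qed

subsection \<open>Derivatives along the circle\<close>

text \<open>Moves from the definition, which rotates to the point and differentiates at t = 0, to a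
  derivative in the angle. The factor i * z undoes the normalisation -i / z.\<close>

lemma circle_has_vector_derivative:
  assumes "circle_differentiable f (cis \<theta>)"
  shows "((\<lambda>x. f (cis x)) has_vector_derivative (\<i> * cis \<theta> * circle_deriv f (cis \<theta>))) (at \<theta>)"
proof -
  define D where "D = vector_derivative (\<lambda>t. f (cis \<theta> * cis t)) (at 0)"
  have "((\<lambda>t. f (cis \<theta> * cis t)) has_vector_derivative D) (at (\<theta> - \<theta>))"
    using assms unfolding circle_differentiable_def D_def by (simp add: vector_derivative_works)
  moreover have "((\<lambda>x. x - \<theta>) has_vector_derivative 1) (at \<theta>)"
    by (auto intro!: derivative_eq_intros)
  ultimately have "(((\<lambda>t. f (cis \<theta> * cis t)) \<circ> (\<lambda>x. x - \<theta>)) has_vector_derivative 1 *\<^sub>R D) (at \<theta>)"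
    by (intro vector_diff_chain_at)
  then show ?thesis by (simp add: o_def cis_mult circle_deriv_def D_def)
qed

lemma circle_derivI:
  assumes "((\<lambda>x. f (cis x)) has_vector_derivative D) (at \<theta>)"
  shows "circle_differentiable f (cis \<theta>)" "circle_deriv f (cis \<theta>) = - \<i> / cis \<theta> * D"
proof -
  have "((\<lambda>x. f (cis x)) has_vector_derivative D) (at (\<theta> + 0))" using assms by simp
  moreover have "((\<lambda>t. \<theta> + t) has_vector_derivative 1) (at 0)"
    by (auto intro!: derivative_eq_intros)
  ultimately have "(((\<lambda>x. f (cis x)) \<circ> (\<lambda>t. \<theta> + t)) has_vector_derivative 1 *\<^sub>R D) (at 0)"
    by (intro vector_diff_chain_at)
  then have *: "((\<lambda>t. f (cis \<theta> * cis t)) has_vector_derivative D) (at 0)"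
    by (simp add: o_def cis_mult)
  then show "circle_differentiable f (cis \<theta>)"
    unfolding circle_differentiable_def by (rule differentiableI_vector)
  show "circle_deriv f (cis \<theta>) = - \<i> / cis \<theta> * D"
    unfolding circle_deriv_def using vector_derivative_at[OF *] by simp
qed

lemma sphere_cisE:
  assumes "z \<in> sphere 0 1"
  obtains \<theta> where "z = cis \<theta>"
proof -
  have "z = cis (Arg z)" using assms rcis_cmod_Arg[of z] by (simp add: rcis_def)
  then show ?thesis using that by blast
qed

text \<open>Iterates of the Euler operator and their closed form are compared on the circle only;
  this allows such an identity to be differentiated.\<close>

lemma circle_deriv_cong:
  assumes "\<And>z. z \<in> sphere 0 1 \<Longrightarrow> f z = g z" "z \<in> sphere 0 1"
  shows "circle_deriv f z = circle_deriv g z"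
proof -
  have "(\<lambda>t. f (z * cis t)) = (\<lambda>t. g (z * cis t))"
    using assms by (auto simp: norm_mult)
  then show ?thesis by (simp add: circle_deriv_def)
qed

lemma cis_powi_has_vector_derivative:
  "((\<lambda>x. cis x powi s) has_vector_derivative (\<i> * of_int s * cis x powi s)) (at x)"
proof -
  have "((\<lambda>z. exp (\<i> * of_int s * z)) has_field_derivative (\<i> * of_int s * exp (\<i> * of_int s * of_real x))) (at (of_real x))"
    by (auto intro!: derivative_eq_intros)
  from has_vector_derivative_real_field[OF this]
  have "((\<lambda>x. cis (of_int s * x)) has_vector_derivative (\<i> * of_int s * cis (of_int s * x))) (at x)"
    by (simp add: cis_conv_exp mult.assoc)
  then show ?thesis by (simp add: cis_power_int)
qed

lemma cis_power_has_vector_derivative: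
  "((\<lambda>x. cis x ^ k) has_vector_derivative (\<i> * of_nat k * cis x ^ k)) (at x)"
  using cis_powi_has_vector_derivative[of "int k"] by simp

text \<open>Integration by parts: the boundary terms cancel by periodicity.\<close>

lemma laurent_coeff_circle_deriv:
  assumes cont: "continuous_on (sphere 0 1) f"
    and ac: "abs_continuous_on_interval 0 (2 * pi) (\<lambda>\<theta>. f (cis \<theta>))"
    and diff: "AE z in circle_measure. circle_differentiable f z"
    and g: "integrable circle_measure g"
    and fg: "AE z in circle_measure. - z * circle_deriv f z = g z"
  shows "laurent_coeff g s = of_int s * laurent_coeff f s"
proof -
  have f: "integrable circle_measure f"
  proof -
    interpret prob_space circle_measure by (rule prob_space_circle_measure)
    show ?thesis using integrable_circle_mult[OF cont, of "\<lambda>_. 1"] by simp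
  qed
  have cc: "continuous_on {0..2 * pi} (\<lambda>\<theta>. f (cis \<theta>))"
    by (rule continuous_on_compose2[OF cont]) (auto intro!: continuous_intros)
  \<comment> \<open>Chosen so that \<open>H (cis \<theta>)\<close> is the angular derivative of
    \<open>F\<close>: the power contributes i * s, and the angular derivative of f is i * z * f' =
    -i * g.\<close>
  define H where "H = (\<lambda>z. z powi s * (\<i> * of_int s * f z - \<i> * g z))"
  have H: "integrable circle_measure H"
    unfolding H_def using f g by (intro integrable_powi_mult) auto
  define F where "F = (\<lambda>\<theta>. cis \<theta> powi s * f (cis \<theta>))"
  have "AE t in lborel. t \<in> {0..2 * pi} \<longrightarrow> (F has_vector_derivative H (cis t)) (at t)"
    using AE_circle_measureD[OF diff] AE_circle_measureD[OF fg]
  proof eventually_elim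
    case (elim t)
    show ?case
    proof
      assume "t \<in> {0..2 * pi}"
      then have 1: "circle_differentiable f (cis t)" and 2: "- cis t * circle_deriv f (cis t) = g (cis t)"
        using elim by auto
      have "(F has_vector_derivative (cis t powi s * (\<i> * cis t * circle_deriv f (cis t)) + \<i> * of_int s * cis t powi s * f (cis t))) (at t)"
        unfolding F_def
        by (rule has_vector_derivative_mult[OF cis_powi_has_vector_derivative circle_has_vector_derivative[OF 1]])
      moreover have "cis t powi s * (\<i> * cis t * circle_deriv f (cis t)) + \<i> * of_int s * cis t powi s * f (cis t) = H (cis t)"
        unfolding H_def 2[symmetric] by (simp add: algebra_simps)
      ultimately show "(F has_vector_derivative H (cis t)) (at t)" by simp
    qed
  qed
  then obtain E where E: "\<And>t. t \<in> space lborel - E \<Longrightarrow> t \<in> {0..2 * pi} \<longrightarrow> (F has_vector_derivative H (cis t)) (at t)"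
    "E \<in> null_sets lborel"
    by (rule AE_E3) blast
  have "((\<lambda>t. H (cis t)) has_integral (F (2 * pi) - F 0)) {0..2 * pi}"
  proof (rule abs_continuous_has_integral)
    show "abs_continuous_on_interval 0 (2 * pi) F"
      unfolding F_def
    proof (rule abs_continuous_on_interval_mult[OF _ ac _ cc])
      show "continuous_on {0..2 * pi} (\<lambda>x. cis x powi s)"
        by (intro continuous_intros) auto
      show "abs_continuous_on_interval 0 (2 * pi) (\<lambda>x. cis x powi s)"
        by (rule abs_continuous_on_interval_C1[OF cis_powi_has_vector_derivative]) (intro continuous_intros, auto)
    qed
    show "negligible E" unfolding negligible_iff_null_sets by (rule null_sets_completionI[OF E(2)])
    show "(F has_vector_derivative H (cis x)) (at x within {0..2 * pi})" if "x \<in> {0..2 * pi} - E" for x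
      by (rule has_vector_derivative_at_within) (use that E(1)[of x] in auto)
  qed simp
  moreover have "F (2 * pi) = F 0" by (simp add: F_def)
  ultimately have "integral {0..2 * pi} (\<lambda>t. H (cis t)) = 0" by (simp add: integral_unique)
  then have "(\<integral>z. H z \<partial>circle_measure) = 0"
    using integral_circle_measure[OF H] by (simp add: set_borel_integral_eq_integral)
  moreover have "(\<integral>z. H z \<partial>circle_measure) = (\<integral>z. (\<i> * of_int s) * (z powi s * f z) - \<i> * (z powi s * g z) \<partial>circle_measure)"
    unfolding H_def by (simp add: algebra_simps)
  moreover have "\<dots> = (\<i> * of_int s) * laurent_coeff f s - \<i> * laurent_coeff g s"
    unfolding laurent_coeff_def using f g
    by (subst Bochner_Integration.integral_diff) (auto intro!: integrable_mult_right integrable_powi_mult)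
  ultimately have "\<i> * (of_int s * laurent_coeff f s) = \<i> * laurent_coeff g s" by (simp add: mult.assoc)
  then show ?thesis by simp
qed

section \<open>Powers of the Euler operator\<close>

text \<open>The classical expansion of the operator -z d/dz raised to the power b, with Stirling
  numbers of the second kind. In this form integrability, continuity and absolute continuity can be
  read off from the plain derivatives of the weight.\<close>

definition euler_power :: "nat \<Rightarrow> (complex \<Rightarrow> complex) \<Rightarrow> complex \<Rightarrow> complex" where
  "euler_power b w z = (- 1) ^ b * (\<Sum>k\<le>b. of_nat (Stirling b k) * z ^ k * (circle_deriv ^^ k) w z)"

lemma euler_power_0 [simp]: "euler_power 0 w = w"
  by (simp add: euler_power_def fun_eq_iff)

text \<open>The recurrence S(b+1, k+1) = (k+1) S(b, k+1) + S(b, k), applied to the result of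
  differentiating each term by the product rule.\<close>

lemma euler_power_Suc_Stirling:
  "(- 1) ^ b * (\<Sum>k\<le>b. of_nat (Stirling b k) * (of_nat k * z ^ k * (circle_deriv ^^ k) w z + z ^ Suc k * (circle_deriv ^^ Suc k) w z)) = - euler_power (Suc b) w z"
proof -
  define d where "d = (\<lambda>k. z ^ k * (circle_deriv ^^ k) w z)"
  have "(\<Sum>k\<le>Suc b. of_nat (Stirling (Suc b) k) * d k) = (\<Sum>k\<le>b. of_nat (Stirling (Suc b) (Suc k)) * d (Suc k))"
    by (subst sum.atMost_Suc_shift) simp
  also have "\<dots> = (\<Sum>k\<le>b. of_nat (Suc k) * of_nat (Stirling b (Suc k)) * d (Suc k)) + (\<Sum>k\<le>b. of_nat (Stirling b k) * d (Suc k))"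
    by (simp add: algebra_simps sum.distrib)
  also have "(\<Sum>k\<le>b. of_nat (Suc k) * of_nat (Stirling b (Suc k)) * d (Suc k)) = (\<Sum>k\<le>Suc b. of_nat k * of_nat (Stirling b k) * d k)"
    by (subst sum.atMost_Suc_shift) simp
  \<comment> \<open>The top term vanishes because S(b, b+1) = 0.\<close>
  also have "\<dots> = (\<Sum>k\<le>b. of_nat k * of_nat (Stirling b k) * d k)" by simp
  finally have "(\<Sum>k\<le>Suc b. of_nat (Stirling (Suc b) k) * d k) = (\<Sum>k\<le>b. of_nat (Stirling b k) * (of_nat k * d k + d (Suc k)))"
    by (simp add: algebra_simps sum.distrib)
  then show ?thesis unfolding euler_power_def d_def by (simp add: mult.assoc)
qed

text \<open>Stated at a single point, so that it also serves for the last derivative, which exists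
  almost everywhere only.\<close>

lemma euler_power_step:
  assumes z: "z \<in> sphere 0 1" and d: "\<And>k. k \<le> b \<Longrightarrow> circle_differentiable ((circle_deriv ^^ k) w) z"
  shows "circle_differentiable (euler_power b w) z"
    "- z * circle_deriv (euler_power b w) z = euler_power (Suc b) w z"
proof -
  obtain \<theta> where \<theta>: "z = cis \<theta>" using sphere_cisE[OF z] .
  have "((\<lambda>x. euler_power b w (cis x)) has_vector_derivative
     ((- 1) ^ b * (\<Sum>k\<le>b. of_nat (Stirling b k) * (cis \<theta> ^ k * (\<i> * cis \<theta> * circle_deriv ((circle_deriv ^^ k) w) (cis \<theta>)) + \<i> * of_nat k * cis \<theta> ^ k * (circle_deriv ^^ k) w (cis \<theta>))))) (at \<theta>)"
    unfolding euler_power_def mult.assoc[of "of_nat (Stirling b _)"]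
    by (intro has_vector_derivative_mult_right has_vector_derivative_sum has_vector_derivative_mult
      cis_power_has_vector_derivative circle_has_vector_derivative) (use d \<theta> in auto)
  note * = circle_derivI[OF this]
  show "circle_differentiable (euler_power b w) z" using *(1) \<theta> by simp
  \<comment> \<open>The factor -z turns the normalisation -i / z into i; together with the i of each
    angular derivative this produces an overall sign -1.\<close>
  have "- z * circle_deriv (euler_power b w) z = \<i> * ((- 1) ^ b * (\<Sum>k\<le>b. of_nat (Stirling b k) * (cis \<theta> ^ k * (\<i> * cis \<theta> * circle_deriv ((circle_deriv ^^ k) w) (cis \<theta>)) + \<i> * of_nat k * cis \<theta> ^ k * (circle_deriv ^^ k) w (cis \<theta>))))"
    unfolding \<theta> *(2) by simp
  also have "\<dots> = - ((- 1) ^ b * (\<Sum>k\<le>b. of_nat (Stirling b k) * (of_nat k * z ^ k * (circle_deriv ^^ k) w z + z ^ Suc k * (circle_deriv ^^ Suc k) w z)))"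
    unfolding \<theta> by (simp add: sum_distrib_left sum_negf[symmetric] algebra_simps sum.distrib)
  also have "\<dots> = euler_power (Suc b) w z" unfolding euler_power_Suc_Stirling by simp
  finally show "- z * circle_deriv (euler_power b w) z = euler_power (Suc b) w z" .
qed

abbreviation euler_op :: "(complex \<Rightarrow> complex) \<Rightarrow> complex \<Rightarrow> complex" where
  "euler_op \<equiv> (\<lambda>f x. - x * circle_deriv f x)"

text \<open>Differentiability is required on the whole circle, because each step differentiates the
  identity obtained in the previous one.\<close>

lemma euler_op_funpow:
  assumes "\<And>k z. k < b \<Longrightarrow> z \<in> sphere 0 1 \<Longrightarrow> circle_differentiable ((circle_deriv ^^ k) w) z" "z \<in> sphere 0 1"
  shows "(euler_op ^^ b) w z = euler_power b w z"
  using assms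
proof (induction b arbitrary: z)
  case (Suc b)
  have "(euler_op ^^ Suc b) w z = - z * circle_deriv ((euler_op ^^ b) w) z" by simp
  also have "circle_deriv ((euler_op ^^ b) w) z = circle_deriv (euler_power b w) z"
    using Suc by (intro circle_deriv_cong) auto
  also have "- z * \<dots> = euler_power (Suc b) w z"
    using Suc by (intro euler_power_step) auto
  finally show ?case .
qed simp

text \<open>Provides an integrable representative \<open>g\<close> of the iterated operator. Where
  the last derivative fails to exist the iterate has an unspecified value, so integrability and
  Fourier coefficients are established for the Stirling expansion instead.\<close>

lemma L1_sym_diff_euler_op:
  assumes w: "w \<in> L1_sym_diff N" and b: "b < N"
  obtains g where "integrable circle_measure g" "AE z in circle_measure. (euler_op ^^ b) w z = g z"
    "\<And>s. laurent_coeff g s = of_int s ^ b * laurent_coeff w s"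
proof -
  have int: "integrable circle_measure ((circle_deriv ^^ j) w)" if "j < N" for j
    using w that by (auto simp: L1_sym_diff_def)
  have intp: "integrable circle_measure (euler_power c w)" if "c < N" for c
    unfolding euler_power_def mult.assoc[of "of_nat (Stirling c _)"] using that
    by (intro integrable_mult_right Bochner_Integration.integrable_sum integrable_circle_mult int) 
       (auto intro!: continuous_intros)
  show ?thesis
  \<comment> \<open>This case includes N = 1, where the weight is merely integrable; every b > 0
    forces N >= 2.\<close>
  proof (cases "b = 0")
    case True
    then show ?thesis using that[of w] int[of 0] b by simp
  next
    case False
    then have N: "N \<ge> 2" using b by simp
    have d: "circle_differentiable ((circle_deriv ^^ j) w) z" if "j < N - 2" "z \<in> sphere 0 1" for j z
      using w N that by (auto simp: L1_sym_diff_def)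
    have c: "continuous_on (sphere 0 1) ((circle_deriv ^^ j) w)" if "j \<le> N - 2" for j
      using w N that by (auto simp: L1_sym_diff_def)
    have dAE: "AE z in circle_measure. circle_differentiable ((circle_deriv ^^ j) w) z" if "j \<le> N - 2" for j
      using w N that d[of j] by (cases "j = N - 2") (auto simp: L1_sym_diff_def)
    have ccis: "continuous_on {0..2 * pi} (\<lambda>\<theta>. f (cis \<theta>))" if "continuous_on (sphere 0 1) f" for f :: "complex \<Rightarrow> complex"
      by (rule continuous_on_compose2[OF that]) (auto intro!: continuous_intros)
    have ac: "abs_continuous_on_interval 0 (2 * pi) (\<lambda>\<theta>. (circle_deriv ^^ j) w (cis \<theta>))" if "j \<le> N - 2" for j
    \<comment> \<open>Absolute continuity is assumed for the order N - 2; lower derivatives are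
      continuously differentiable along the circle.\<close>
    proof (cases "j = N - 2")
      case True
      then show ?thesis using w N by (auto simp: L1_sym_diff_def)
    next
      case False
      then have j: "j < N - 2" using that by simp
      have "continuous_on {0..2 * pi} (\<lambda>\<theta>. circle_deriv ((circle_deriv ^^ j) w) (cis \<theta>))"
        using ccis[OF c[of "Suc j"]] j by simp
      then show ?thesis using d[OF j]
        by (intro abs_continuous_on_interval_C1[OF circle_has_vector_derivative]) (auto intro!: continuous_intros)
    qed
    have step: "laurent_coeff (euler_power (Suc c) w) s = of_int s * laurent_coeff (euler_power c w) s"
      if cN: "c \<le> N - 2" for c s
    proof (rule laurent_coeff_circle_deriv)
      show "continuous_on (sphere 0 1) (euler_power c w)"
        unfolding euler_power_def using cN by (intro continuous_intros c) auto
      have pow: "abs_continuous_on_interval 0 (2 * pi) (\<lambda>x. cis x ^ k)" for k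
        by (rule abs_continuous_on_interval_C1[OF cis_power_has_vector_derivative]) (intro continuous_intros)
      have const: "abs_continuous_on_interval 0 (2 * pi) (\<lambda>x. a)" for a
        by (rule abs_continuous_on_interval_lipschitz[where L = 0]) simp
      show "abs_continuous_on_interval 0 (2 * pi) (\<lambda>\<theta>. euler_power c w (cis \<theta>))"
        unfolding euler_power_def mult.assoc[of "of_nat (Stirling c _)"]
        using cN by (intro abs_continuous_on_interval_mult abs_continuous_on_interval_sum const pow ac
            continuous_intros ccis c) auto
      have "AE z in circle_measure. \<forall>k\<in>{..c}. circle_differentiable ((circle_deriv ^^ k) w) z"
        using cN by (intro AE_finite_allI dAE) auto
      then have "AE z in circle_measure. circle_differentiable (euler_power c w) z \<and>
          - z * circle_deriv (euler_power c w) z = euler_power (Suc c) w z"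
        using AE_space by eventually_elim (use euler_power_step[of _ c w] in auto)
      then show "AE z in circle_measure. circle_differentiable (euler_power c w) z"
        "AE z in circle_measure. - z * circle_deriv (euler_power c w) z = euler_power (Suc c) w z"
        by (auto elim: eventually_mono)
      show "integrable circle_measure (euler_power (Suc c) w)" using cN N by (intro intp) auto
    qed
    have lc: "laurent_coeff (euler_power c w) s = of_int s ^ c * laurent_coeff w s" if "c < N" for c s
      using that
    proof (induction c)
      case (Suc c)
      then show ?case using step[of c s] by simp
    qed simp
    have "AE z in circle_measure. (euler_op ^^ b) w z = euler_power b w z"
    proof -
      obtain c where bc: "b = Suc c" using False by (cases b) auto
      then have cN: "c \<le> N - 2" using b by simp
      \<comment> \<open>All steps but the last hold at every point of the circle. The derivative at
        an exceptional-free point z sees the values near z, so equality almost everywhere would not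
        suffice here.\<close>
      have eq: "(euler_op ^^ c) w z = euler_power c w z" if "z \<in> sphere 0 1" for z
        using d cN that by (intro euler_op_funpow) auto
      have "AE z in circle_measure. \<forall>k\<in>{..c}. circle_differentiable ((circle_deriv ^^ k) w) z"
        using cN by (intro AE_finite_allI dAE) auto
      then show ?thesis using AE_space
      proof eventually_elim
        case (elim z)
        then have z: "z \<in> sphere 0 1" by simp
        have "(euler_op ^^ b) w z = - z * circle_deriv ((euler_op ^^ c) w) z" by (simp add: bc)
        also have "circle_deriv ((euler_op ^^ c) w) z = circle_deriv (euler_power c w) z"
          using eq z by (intro circle_deriv_cong) auto
        also have "- z * \<dots> = euler_power b w z"
          unfolding bc using elim z by (intro euler_power_step) auto
        finally show ?case .
      qed
    qed
    then show ?thesis using that intp[OF b] lc[OF b] by blast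
  qed
qed

subsection \<open>Determinants on the torus\<close>

lemma product_sigma_finite_circle: "product_sigma_finite (\<lambda>_. circle_measure)"
proof -
  interpret prob_space circle_measure by (rule prob_space_circle_measure)
  show ?thesis by unfold_locales
qed

text \<open>Every term of the Leibniz expansion is a product of functions of one coordinate each, so
  Fubini factorises its integral; the factors reassemble into a determinant.\<close>

lemma integral_torus_det:
  assumes g: "\<And>b. b < N \<Longrightarrow> integrable circle_measure (g b)"
  shows "(\<integral>z. (\<Prod>a<N. z a powi s a) * Determinant.det (mat N N (\<lambda>(a, b). g b (z a))) \<partial>torus_measure N)
    = Determinant.det (mat N N (\<lambda>(a, b). laurent_coeff (g b) (s a)))"
proof -
  interpret product_sigma_finite "\<lambda>_::nat. circle_measure" by (rule product_sigma_finite_circle)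
  let ?P = "{p. p permutes {0..<N}}"
  have pN: "p a < N" if "p \<in> ?P" "a < N" for p a
    using that permutes_in_image[of p "{0..<N}" a] by auto
  have "(\<Prod>a<N. z a powi s a) * Determinant.det (mat N N (\<lambda>(a, b). g b (z a))) =
    (\<Sum>p\<in>?P. signof p * (\<Prod>a<N. z a powi s a * g (p a) (z a)))" for z :: "nat \<Rightarrow> complex"
  proof -
    have "Determinant.det (mat N N (\<lambda>(a, b). g b (z a))) = (\<Sum>p\<in>?P. signof p * (\<Prod>a<N. g (p a) (z a)))"
      by (subst det_def'[of _ N]) (auto simp: pN lessThan_atLeast0 intro!: sum.cong prod.cong)
    then show ?thesis by (simp add: sum_distrib_left prod.distrib mult.left_commute)
  qed
  moreover have int: "integrable (torus_measure N) (\<lambda>z. \<Prod>a<N. z a powi s a * g (p a) (z a))" if "p \<in> ?P" for p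
    unfolding torus_measure_def
    by (rule product_integrable_prod[where f = "\<lambda>a z. z powi s a * g (p a) z"])
      (use pN[OF that] in \<open>auto intro!: integrable_powi_mult g\<close>)
  ultimately have "(\<integral>z. (\<Prod>a<N. z a powi s a) * Determinant.det (mat N N (\<lambda>(a, b). g b (z a))) \<partial>torus_measure N)
    = (\<integral>z. (\<Sum>p\<in>?P. signof p * (\<Prod>a<N. z a powi s a * g (p a) (z a))) \<partial>torus_measure N)"
    by simp
  also have "\<dots> = (\<Sum>p\<in>?P. \<integral>z. signof p * (\<Prod>a<N. z a powi s a * g (p a) (z a)) \<partial>torus_measure N)"
    by (rule Bochner_Integration.integral_sum) (rule integrable_mult_right, rule int)
  also have "\<dots> = (\<Sum>p\<in>?P. signof p * (\<Prod>a<N. laurent_coeff (g (p a)) (s a)))"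
  proof (rule sum.cong)
    fix p assume p: "p \<in> ?P"
    have "(\<integral>z. (\<Prod>a<N. z a powi s a * g (p a) (z a)) \<partial>torus_measure N) = (\<Prod>a<N. laurent_coeff (g (p a)) (s a))"
      unfolding torus_measure_def laurent_coeff_def
      by (rule product_integral_prod[where f = "\<lambda>a z. z powi s a * g (p a) z"])
        (use pN[OF p] in \<open>auto intro!: integrable_powi_mult g\<close>)
    then show "(\<integral>z. signof p * (\<Prod>a<N. z a powi s a * g (p a) (z a)) \<partial>torus_measure N) = signof p * (\<Prod>a<N. laurent_coeff (g (p a)) (s a))"
      by simp
  qed simp
  also have "\<dots> = Determinant.det (mat N N (\<lambda>(a, b). laurent_coeff (g b) (s a)))"
    by (subst det_def'[of _ N]) (auto simp: pN lessThan_atLeast0 intro!: sum.cong prod.cong)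
  finally show ?thesis .
qed

text \<open>Integrate over coordinate \<open>a\<close> first: for fixed other coordinates, the bad
  set is a single point, which is null.\<close>

lemma AE_torus_component_neq:
  assumes ab: "a < N" "b < N" "a \<noteq> b"
  shows "AE z in torus_measure N. z a \<noteq> z b"
proof -
  interpret product_sigma_finite "\<lambda>_::nat. circle_measure" by (rule product_sigma_finite_circle)
  define I where "I = {..<N} - {a}"
  have I: "finite I" "a \<notin> I" "insert a I = {..<N}" "b \<in> I" using ab by (auto simp: I_def)
  have id: "(\<lambda>z. z) \<in> borel_measurable circle_measure"
    by (rule borel_measurable_circle_measure) (rule continuous_on_id)
  have comp: "(\<lambda>z. z i) \<in> borel_measurable (PiM {..<N} (\<lambda>_. circle_measure))" if "i < N" for i
    by (rule measurable_compose[OF measurable_component_singleton[where M = "\<lambda>_. circle_measure"] id]) (use that in simp)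
  define f where "f = (\<lambda>z::nat \<Rightarrow> complex. indicator {0} (z a - z b) :: ennreal)"
  have f: "f \<in> borel_measurable (PiM {..<N} (\<lambda>_. circle_measure))"
    unfolding f_def using comp[OF ab(1)] comp[OF ab(2)] by measurable
  have "(\<integral>\<^sup>+z. f z \<partial>PiM (insert a I) (\<lambda>_. circle_measure)) =
    (\<integral>\<^sup>+x. (\<integral>\<^sup>+y. f (x(a := y)) \<partial>circle_measure) \<partial>PiM I (\<lambda>_. circle_measure))"
    by (rule product_nn_integral_insert) (use I f in auto)
  also have "\<dots> = (\<integral>\<^sup>+x. 0 \<partial>PiM I (\<lambda>_. circle_measure))"
  proof (rule nn_integral_cong)
    fix x :: "nat \<Rightarrow> complex"
    have "(\<integral>\<^sup>+y. f (x(a := y)) \<partial>circle_measure) = (\<integral>\<^sup>+y. 0 \<partial>circle_measure)"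
      by (rule nn_integral_cong_AE) (use AE_circle_measure_neq[of "x b"] ab in \<open>auto elim!: eventually_mono simp: f_def\<close>)
    then show "(\<integral>\<^sup>+y. f (x(a := y)) \<partial>circle_measure) = 0" by simp
  qed
  finally have "(\<integral>\<^sup>+z. f z \<partial>PiM {..<N} (\<lambda>_. circle_measure)) = 0" using I by simp
  then have "AE z in torus_measure N. f z = 0" unfolding torus_measure_def by (subst (asm) nn_integral_0_iff_AE[OF f])
  then show ?thesis by eventually_elim (auto simp: f_def)
qed

lemma AE_vandermonde_neq_0: "AE z in torus_measure N. vandermonde N z \<noteq> 0"
proof -
  have "AE z in torus_measure N. \<forall>b\<in>{..<N}. \<forall>a\<in>{..<b}. z b \<noteq> z a"
    by (intro AE_finite_allI AE_torus_component_neq) auto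
  then show ?thesis by eventually_elim (simp add: vandermonde_def)
qed

text \<open>A kernel vector would be the coefficient list of a nonzero polynomial of degree below N
  with N distinct roots.\<close>

lemma det_powers_neq_0:
  fixes x :: "nat \<Rightarrow> 'a :: field"
  assumes inj: "inj_on x {..<N}"
  shows "Determinant.det (mat N N (\<lambda>(a, b). x a ^ b)) \<noteq> 0"
proof
  assume "Determinant.det (mat N N (\<lambda>(a, b). x a ^ b)) = 0"
  then obtain v where v: "v \<in> carrier_vec N" "v \<noteq> 0\<^sub>v N" "mat N N (\<lambda>(a, b). x a ^ b) *\<^sub>v v = 0\<^sub>v N"
    using det_0_iff_vec_prod_zero_field[of "mat N N (\<lambda>(a, b). x a ^ b)" N] by auto
  define p where "p = (\<Sum>b<N. monom (v $ b) b)"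
  have root: "poly p (x a) = 0" if "a < N" for a
  proof -
    have "poly p (x a) = (mat N N (\<lambda>(a, b). x a ^ b) *\<^sub>v v) $ a"
      using that v(1) by (simp add: p_def poly_sum poly_monom scalar_prod_def lessThan_atLeast0 mult.commute)
    then show ?thesis using v(3) that by simp
  qed
  have coeff: "poly.coeff p b = (if b < N then v $ b else 0)" for b
    by (simp add: p_def coeff_sum if_distrib cong: if_cong)
  have "p \<noteq> 0"
  proof
    assume "p = 0"
    then have "v $ b = 0" if "b < N" for b using coeff[of b] that by simp
    then show False using v(1,2) by auto
  qed
  moreover have "x ` {..<N} \<subseteq> {y. poly p y = 0}" using root by auto
  ultimately have "N \<le> card {y. poly p y = 0}"
    using inj poly_roots_finite card_mono by (metis card_image card_lessThan)
  also have "\<dots> \<le> degree p" using \<open>p \<noteq> 0\<close> by (rule card_poly_roots_bound)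
  finally have "poly.coeff p (degree p) = 0" using coeff by simp
  then show False using \<open>p \<noteq> 0\<close> by simp
qed

lemma det_mult_rows:
  fixes c :: "nat \<Rightarrow> 'a :: comm_ring_1"
  shows "Determinant.det (mat N N (\<lambda>(a, b). f a b * c a)) = (\<Prod>a<N. c a) * Determinant.det (mat N N (\<lambda>(a, b). f a b))"
proof -
  let ?P = "{p. p permutes {0..<N}}"
  have pN: "p a < N" if "p \<in> ?P" "a < N" for p a
    using that permutes_in_image[of p "{0..<N}" a] by auto
  have *: "Determinant.det (mat N N (\<lambda>(a, b). h a b)) = (\<Sum>p\<in>?P. signof p * (\<Prod>a<N. h a (p a)))" for h :: "nat \<Rightarrow> nat \<Rightarrow> 'a"
    by (subst det_def'[of _ N]) (auto simp: pN lessThan_atLeast0 intro!: sum.cong prod.cong)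
  show ?thesis unfolding * by (simp add: prod.distrib sum_distrib_left ac_simps)
qed

text \<open>In the matrix of Fourier coefficients, row \<open>a\<close> is the coefficient of the
  weight at \<open>s a\<close> times the powers of \<open>s a\<close>. Pulling these row factors out
  leaves a Vandermonde determinant that does not depend on the weight.\<close>

lemma det_euler_op_AE:
  assumes w: "w \<in> L1_sym_diff N"
  obtains g where "\<And>b. b < N \<Longrightarrow> integrable circle_measure (g b)"
    "AE z in torus_measure N. Determinant.det (mat N N (\<lambda>(a, b). (euler_op ^^ b) w (z a))) = Determinant.det (mat N N (\<lambda>(a, b). g b (z a)))"
    "\<And>s. Determinant.det (mat N N (\<lambda>(a, b). laurent_coeff (g b) (s a))) =
      (\<Prod>a<N. laurent_coeff w (s a)) * Determinant.det (mat N N (\<lambda>(a, b). of_int (s a) ^ b))"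
proof -
  have "\<forall>b. \<exists>g. b < N \<longrightarrow> integrable circle_measure g \<and> (AE z in circle_measure. (euler_op ^^ b) w z = g z) \<and>
    (\<forall>s. laurent_coeff g s = of_int s ^ b * laurent_coeff w s)"
  proof
    fix b
    show "\<exists>g. b < N \<longrightarrow> integrable circle_measure g \<and> (AE z in circle_measure. (euler_op ^^ b) w z = g z) \<and>
      (\<forall>s. laurent_coeff g s = of_int s ^ b * laurent_coeff w s)"
    proof (cases "b < N")
      case True
      then show ?thesis by (rule L1_sym_diff_euler_op[OF w]) blast
    qed simp
  qed
  from choice[OF this] obtain g where g: "\<And>b. b < N \<Longrightarrow> integrable circle_measure (g b)"
    "\<And>b. b < N \<Longrightarrow> AE z in circle_measure. (euler_op ^^ b) w z = g b z"
    "\<And>b s. b < N \<Longrightarrow> laurent_coeff (g b) s = of_int s ^ b * laurent_coeff w s" by blast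
  have 2: "AE z in torus_measure N. Determinant.det (mat N N (\<lambda>(a, b). (euler_op ^^ b) w (z a))) = Determinant.det (mat N N (\<lambda>(a, b). g b (z a)))"
  proof -
    have "AE z in torus_measure N. \<forall>a\<in>{..<N}. \<forall>b\<in>{..<N}. (euler_op ^^ b) w (z a) = g b (z a)"
      unfolding torus_measure_def
      by (intro AE_finite_allI AE_PiM_component[OF prob_space_circle_measure] g(2)) auto
    then show ?thesis
      by eventually_elim (auto intro!: arg_cong[where f = Determinant.det] cong_mat)
  qed
  have 3: "Determinant.det (mat N N (\<lambda>(a, b). laurent_coeff (g b) (s a))) =
      (\<Prod>a<N. laurent_coeff w (s a)) * Determinant.det (mat N N (\<lambda>(a, b). of_int (s a) ^ b))" for s
  proof -
    have "mat N N (\<lambda>(a, b). laurent_coeff (g b) (s a)) = mat N N (\<lambda>(a, b). of_int (s a) ^ b * laurent_coeff w (s a))"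
      by (auto intro!: cong_mat simp: g(3))
    then show ?thesis by (simp add: det_mult_rows)
  qed
  show ?thesis using that[OF g(1) 2 3] .
qed

text \<open>The two determinants, each with its normalisation, are integrated against the monomial
  with exponents \<open>s\<close>. Distinct exponents make the common Vandermonde determinant
  nonzero, so it cancels.\<close>

lemma laurent_coeff_prod_eq:
  assumes w1: "w\<^sub>1 \<in> L1_sym_diff N" and w2: "w\<^sub>2 \<in> L1_sym_diff N"
    and eq: "AE z in torus_measure N. polya_density N w\<^sub>1 z = polya_density N w\<^sub>2 z"
    and s: "inj_on s {..<N}"
  shows "(\<Prod>a<N. laurent_coeff w\<^sub>1 (s a)) / (\<Prod>j<N. laurent_coeff w\<^sub>1 (int j)) =
    (\<Prod>a<N. laurent_coeff w\<^sub>2 (s a)) / (\<Prod>j<N. laurent_coeff w\<^sub>2 (int j))"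
proof -
  obtain g1 where g1: "\<And>b. b < N \<Longrightarrow> integrable circle_measure (g1 b)"
    "AE z in torus_measure N. Determinant.det (mat N N (\<lambda>(a, b). (euler_op ^^ b) w\<^sub>1 (z a))) = Determinant.det (mat N N (\<lambda>(a, b). g1 b (z a)))"
    "\<And>s. Determinant.det (mat N N (\<lambda>(a, b). laurent_coeff (g1 b) (s a))) =
      (\<Prod>a<N. laurent_coeff w\<^sub>1 (s a)) * Determinant.det (mat N N (\<lambda>(a, b). of_int (s a) ^ b))"
    by (rule det_euler_op_AE[OF w1]) blast
  obtain g2 where g2: "\<And>b. b < N \<Longrightarrow> integrable circle_measure (g2 b)"
    "AE z in torus_measure N. Determinant.det (mat N N (\<lambda>(a, b). (euler_op ^^ b) w\<^sub>2 (z a))) = Determinant.det (mat N N (\<lambda>(a, b). g2 b (z a)))"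
    "\<And>s. Determinant.det (mat N N (\<lambda>(a, b). laurent_coeff (g2 b) (s a))) =
      (\<Prod>a<N. laurent_coeff w\<^sub>2 (s a)) * Determinant.det (mat N N (\<lambda>(a, b). of_int (s a) ^ b))"
    by (rule det_euler_op_AE[OF w2]) blast
  \<comment> \<open>The part of the normalisation that depends on the weight; the factorials are the
    same on both sides.\<close>
  define c where "c = (\<lambda>w. 1 / (\<Prod>j<N. laurent_coeff w (int j)))"
  define d where "d = (\<lambda>g. \<lambda>z::nat \<Rightarrow> complex. Determinant.det (mat N N (\<lambda>(a, b). g b (z a))) :: complex)"
  have pd: "polya_density N w z = vandermonde N z / (fact N * (\<Prod>j<N. fact j)) * (c w * Determinant.det (mat N N (\<lambda>(a, b). (euler_op ^^ b) w (z a))))" for w z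
    by (simp add: polya_density_def c_def prod.distrib field_simps)
  have fact0: "fact N * (\<Prod>j<N. fact j) \<noteq> (0::complex)" by simp
  have "AE z in torus_measure N. c w\<^sub>1 * d g1 z = c w\<^sub>2 * d g2 z"
    using eq g1(2) g2(2) AE_vandermonde_neq_0
  proof eventually_elim
    case (elim z)
    then have "vandermonde N z / (fact N * (\<Prod>j<N. fact j)) * (c w\<^sub>1 * d g1 z) = vandermonde N z / (fact N * (\<Prod>j<N. fact j)) * (c w\<^sub>2 * d g2 z)"
      unfolding pd d_def by (simp only:)
    then show ?case using elim(4) fact0 by (metis divide_eq_0_iff mult_left_cancel)
  qed
  define P where "P = (\<lambda>z::nat \<Rightarrow> complex. \<Prod>a<N. z a powi s a)"
  have "AE z in torus_measure N. c w\<^sub>1 * (P z * d g1 z) = c w\<^sub>2 * (P z * d g2 z)"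
    using \<open>AE z in torus_measure N. c w\<^sub>1 * d g1 z = c w\<^sub>2 * d g2 z\<close>
    by eventually_elim (simp add: mult.left_commute)
  moreover have m: "(\<lambda>z. P z * d g z) \<in> borel_measurable (torus_measure N)" if "\<And>b. b < N \<Longrightarrow> integrable circle_measure (g b)" for g
  proof -
    have pN: "p a < N" if "p permutes {0..<N}" "a < N" for p a
      using that permutes_in_image[of p "{0..<N}" a] by auto
    have "d g = (\<lambda>z. \<Sum>p | p permutes {0..<N}. signof p * (\<Prod>a<N. g (p a) (z a)))"
      unfolding d_def by (rule ext, subst det_def'[of _ N]) (auto simp: pN lessThan_atLeast0 intro!: sum.cong prod.cong)
    moreover have "(\<lambda>z. g b (z a)) \<in> borel_measurable (torus_measure N)" if "a < N" "b < N" for a b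
      unfolding torus_measure_def
      by (rule measurable_compose[OF measurable_component_singleton[where M = "\<lambda>_. circle_measure"]]) (use that \<open>b < N \<Longrightarrow> integrable circle_measure (g b)\<close> in auto)
    ultimately have "d g \<in> borel_measurable (torus_measure N)"
      by (auto intro!: borel_measurable_sum borel_measurable_times borel_measurable_const borel_measurable_prod simp: pN)
    moreover have "P \<in> borel_measurable (torus_measure N)"
      unfolding P_def torus_measure_def
      by (intro borel_measurable_prod measurable_compose[OF measurable_component_singleton[where M = "\<lambda>_. circle_measure"] borel_measurable_circle_measure[OF continuous_on_powi_sphere]]) auto
    ultimately show ?thesis by (rule borel_measurable_times[rotated])
  qed
  ultimately have "(\<integral>z. c w\<^sub>1 * (P z * d g1 z) \<partial>torus_measure N) = (\<integral>z. c w\<^sub>2 * (P z * d g2 z) \<partial>torus_measure N)"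
    by (intro integral_cong_AE borel_measurable_times borel_measurable_const m g1(1) g2(1))
  then have "c w\<^sub>1 * (\<integral>z. P z * d g1 z \<partial>torus_measure N) = c w\<^sub>2 * (\<integral>z. P z * d g2 z \<partial>torus_measure N)" by simp
  then have "c w\<^sub>1 * Determinant.det (mat N N (\<lambda>(a, b). laurent_coeff (g1 b) (s a))) = c w\<^sub>2 * Determinant.det (mat N N (\<lambda>(a, b). laurent_coeff (g2 b) (s a)))"
    unfolding P_def d_def using integral_torus_det[OF g1(1)] integral_torus_det[OF g2(1)] by simp
  then have "c w\<^sub>1 * (\<Prod>a<N. laurent_coeff w\<^sub>1 (s a)) * Determinant.det (mat N N (\<lambda>(a, b). complex_of_int (s a) ^ b)) =
     c w\<^sub>2 * (\<Prod>a<N. laurent_coeff w\<^sub>2 (s a)) * Determinant.det (mat N N (\<lambda>(a, b). complex_of_int (s a) ^ b))"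
    unfolding g1(3) g2(3) by (simp add: mult.assoc)
  moreover have "Determinant.det (mat N N (\<lambda>(a, b). complex_of_int (s a) ^ b)) \<noteq> 0"
    using s by (intro det_powers_neq_0) (auto simp: inj_on_def)
  ultimately have "c w\<^sub>1 * (\<Prod>a<N. laurent_coeff w\<^sub>1 (s a)) = c w\<^sub>2 * (\<Prod>a<N. laurent_coeff w\<^sub>2 (s a))"
    by (rule mult_right_cancel[THEN iffD1, rotated])
  then show ?thesis by (simp add: c_def)
qed

section \<open>From coefficient identities back to the weights\<close>

text \<open>On the circle conjugation turns z to the power s into z to the power -s, and the
  symmetry of the weight adds N - 1 to the exponent.\<close>

lemma cnj_laurent_coeff:
  assumes w: "w \<in> L1_sym N" and N: "N \<ge> 1"
  shows "cnj (laurent_coeff w s) = laurent_coeff w (int N - 1 - s)"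
proof -
  have wi: "integrable circle_measure w" and sym: "AE z in circle_measure. cnj (w z) = z ^ (N - 1) * w z"
    using w by (auto simp: L1_sym_def)
  have "cnj (laurent_coeff w s) = (\<integral>z. cnj (z powi s * w z) \<partial>circle_measure)"
    unfolding laurent_coeff_def by (rule Bochner_Integration.integral_cnj[symmetric])
  also have "\<dots> = laurent_coeff w (int N - 1 - s)"
    unfolding laurent_coeff_def
  proof (rule integral_cong_AE)
    show "(\<lambda>z. z powi (int N - 1 - s) * w z) \<in> borel_measurable circle_measure"
      by (rule borel_measurable_integrable[OF integrable_powi_mult[OF wi]])
    show "(\<lambda>z. cnj (z powi s * w z)) \<in> borel_measurable circle_measure"
      by (rule borel_measurable_integrable) (simp only: integrable_cnj integrable_powi_mult[OF wi])
    show "AE z in circle_measure. cnj (z powi s * w z) = z powi (int N - 1 - s) * w z"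
      using sym AE_space
    proof eventually_elim
      case (elim z)
      then have z0: "z \<noteq> 0" "norm z = 1" by auto
      have "z * cnj z = 1" using z0 by (simp add: complex_norm_square[symmetric])
      then have inv: "cnj z = inverse z" using z0 by (simp add: field_simps)
      have "cnj (z powi s * w z) = (inverse z) powi s * (z ^ (N - 1) * w z)"
        using elim by (simp add: inv)
      also have "(inverse z) powi s = z powi (- s)" by (simp add: power_int_minus power_int_inverse)
      \<comment> \<open>Natural subtraction on the left: for N = 0 the exponents would
        differ.\<close>
      also have "z ^ (N - 1) = z powi (int N - 1)" using N by (simp add: power_int_def nat_diff_distrib')
      also have "z powi (- s) * (z powi (int N - 1) * w z) = z powi (int N - 1 - s) * w z"
        using z0 by (simp add: power_int_diff power_int_minus power_int_add field_simps)
      finally show ?case .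
    qed
  qed
  finally show ?thesis .
qed

lemma AE_eq_mult_of_laurent_coeff:
  assumes "integrable circle_measure v" "integrable circle_measure w"
    and "\<And>s. laurent_coeff v s = c * laurent_coeff w s"
  shows "AE z in circle_measure. v z = c * w z"
proof -
  have "AE z in circle_measure. v z - c * w z = 0"
  proof (rule laurent_coeff_eq_0_imp_AE_0)
    fix s
    have "laurent_coeff (\<lambda>z. v z - c * w z) s = (\<integral>z. z powi s * v z - c * (z powi s * w z) \<partial>circle_measure)"
      unfolding laurent_coeff_def by (simp add: algebra_simps)
    also have "\<dots> = laurent_coeff v s - c * laurent_coeff w s"
      unfolding laurent_coeff_def using assms(1,2)
      by (subst Bochner_Integration.integral_diff) (auto intro!: integrable_mult_right integrable_powi_mult)
    finally show "laurent_coeff (\<lambda>z. v z - c * w z) s = 0" using assms(3) by simp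
  qed (use assms in auto)
  then show ?thesis by simp
qed

text \<open>Swapping one of the frequencies \<open>0, \<dots>, N - 1\<close> for an outside one compares single coefficients.\<close>

lemma laurent_coeff_cross_mult:
  assumes w1: "w\<^sub>1 \<in> L1_sym_diff N" and w2: "w\<^sub>2 \<in> L1_sym_diff N"
    and eq: "AE z in torus_measure N. polya_density N w\<^sub>1 z = polya_density N w\<^sub>2 z"
    and nz1: "\<And>j. j < N \<Longrightarrow> laurent_coeff w\<^sub>1 (int j) \<noteq> 0" and nz2: "\<And>j. j < N \<Longrightarrow> laurent_coeff w\<^sub>2 (int j) \<noteq> 0"
    and j: "j < N" and t: "t \<notin> {0..int N - 1}"
  shows "laurent_coeff w\<^sub>1 t * laurent_coeff w\<^sub>2 (int j) = laurent_coeff w\<^sub>2 t * laurent_coeff w\<^sub>1 (int j)"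
proof -
  \<comment> \<open>Still injective, as t lies outside 0, ..., N - 1; all factors except those at t
    and j cancel in the quotient.\<close>
  define s where "s = int(j := t)"
  have "inj_on s {..<N}" using t by (auto simp: s_def inj_on_def)
  note e = laurent_coeff_prod_eq[OF w1 w2 eq this]
  have "(\<Prod>a<N. laurent_coeff w (s a)) / (\<Prod>a<N. laurent_coeff w (int a)) = laurent_coeff w t / laurent_coeff w (int j)"
    if nz: "\<And>j. j < N \<Longrightarrow> laurent_coeff w (int j) \<noteq> 0" for w
  proof -
    have "(\<Prod>a<N. laurent_coeff w (s a)) = laurent_coeff w t * (\<Prod>a\<in>{..<N} - {j}. laurent_coeff w (int a))"
      using j by (subst prod.remove[of _ j]) (auto simp: s_def)
    moreover have "(\<Prod>a<N. laurent_coeff w (int a)) = laurent_coeff w (int j) * (\<Prod>a\<in>{..<N} - {j}. laurent_coeff w (int a))"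
      using j by (subst prod.remove[of _ j]) auto
    moreover have "(\<Prod>a\<in>{..<N} - {j}. laurent_coeff w (int a)) \<noteq> 0" using nz by auto
    ultimately show ?thesis by simp
  qed
  then have "laurent_coeff w\<^sub>1 t / laurent_coeff w\<^sub>1 (int j) = laurent_coeff w\<^sub>2 t / laurent_coeff w\<^sub>2 (int j)"
    using e nz1 nz2 by metis
  then show ?thesis using nz1[OF j] nz2[OF j] by (simp add: field_simps)
qed

theorem theorem1:
  fixes N :: nat and \<omega>\<^sub>1 \<omega>\<^sub>2 :: "complex \<Rightarrow> complex"
    and M\<^sub>1 M\<^sub>2 :: "complex mat measure" and s\<^sub>0 :: int
  assumes "N \<ge> 1"
    and "cyclic_polya_ensemble N \<omega>\<^sub>1 M\<^sub>1"
    and "cyclic_polya_ensemble N \<omega>\<^sub>2 M\<^sub>2"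
    and "s\<^sub>0 \<notin> {0..int N - 1}"
    and "laurent_coeff \<omega>\<^sub>1 s\<^sub>0 \<noteq> 0"
    and "laurent_coeff \<omega>\<^sub>2 s\<^sub>0 \<noteq> 0"
    and "AE z in torus_measure N. polya_density N \<omega>\<^sub>1 z = polya_density N \<omega>\<^sub>2 z"
  shows "(odd N \<longrightarrow> (\<exists>C::real. C > 0 \<and>
            (AE z in circle_measure. \<omega>\<^sub>1 z = complex_of_real C * \<omega>\<^sub>2 z))) \<and>
         (even N \<longrightarrow> (\<exists>C::real. C \<noteq> 0 \<and>
            (AE z in circle_measure. \<omega>\<^sub>1 z = complex_of_real C * \<omega>\<^sub>2 z)))"
proof -
  note N = assms(1) and s0 = assms(4-6)
  have w: "\<omega>\<^sub>1 \<in> L1_sym_diff N" "\<omega>\<^sub>2 \<in> L1_sym_diff N"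
    and re: "(\<Prod>j<N. laurent_coeff \<omega>\<^sub>1 (int j)) \<in> \<real>" "(\<Prod>j<N. laurent_coeff \<omega>\<^sub>2 (int j)) \<in> \<real>"
    and pos: "Re (\<Prod>j<N. laurent_coeff \<omega>\<^sub>1 (int j)) > 0" "Re (\<Prod>j<N. laurent_coeff \<omega>\<^sub>2 (int j)) > 0"
    using assms(2,3) by (auto simp: cyclic_polya_ensemble_def)
  have "(\<Prod>j<N. laurent_coeff \<omega>\<^sub>1 (int j)) \<noteq> 0" "(\<Prod>j<N. laurent_coeff \<omega>\<^sub>2 (int j)) \<noteq> 0"
    using pos by (metis less_irrefl zero_complex.sel(1))+
  then have nz: "laurent_coeff \<omega>\<^sub>1 (int j) \<noteq> 0" "laurent_coeff \<omega>\<^sub>2 (int j) \<noteq> 0" if "j < N" for j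
    using that by auto
  have cross: "laurent_coeff \<omega>\<^sub>1 t * laurent_coeff \<omega>\<^sub>2 (int j) = laurent_coeff \<omega>\<^sub>2 t * laurent_coeff \<omega>\<^sub>1 (int j)"
    if "j < N" "t \<notin> {0..int N - 1}" for j t
    by (rule laurent_coeff_cross_mult[OF w assms(7)]) (use nz that in auto)
  have sym: "\<omega>\<^sub>1 \<in> L1_sym N" "\<omega>\<^sub>2 \<in> L1_sym N"
    and int: "integrable circle_measure \<omega>\<^sub>1" "integrable circle_measure \<omega>\<^sub>2"
    using w by (auto simp: L1_sym_diff_def L1_sym_def)
  define C where "C = laurent_coeff \<omega>\<^sub>1 s\<^sub>0 / laurent_coeff \<omega>\<^sub>2 s\<^sub>0"
  \<comment> \<open>The outside index is \<open>s\<^sub>0\<close>: both coefficients there are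
    nonzero, so the cross relation fixes the ratio at every inner j.\<close>
  have inside: "laurent_coeff \<omega>\<^sub>1 (int j) = C * laurent_coeff \<omega>\<^sub>2 (int j)" if "j < N" for j
    using cross[OF that s0(1)] s0(3) by (simp add: C_def field_simps)
  have outside: "laurent_coeff \<omega>\<^sub>1 t = C * laurent_coeff \<omega>\<^sub>2 t" if "t \<notin> {0..int N - 1}" for t
  proof -
    have N0: "0 < N" using N by simp
    \<comment> \<open>The inner index 0 serves as reference, its coefficient being nonzero; outer
      coefficients may themselves vanish.\<close>
    have "laurent_coeff \<omega>\<^sub>1 t * laurent_coeff \<omega>\<^sub>2 0 = C * laurent_coeff \<omega>\<^sub>2 t * laurent_coeff \<omega>\<^sub>2 0"
      using cross[OF N0 that] inside[OF N0] by (simp add: mult_ac)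
    then show ?thesis using nz(2)[OF N0] by simp
  qed
  have all: "laurent_coeff \<omega>\<^sub>1 t = C * laurent_coeff \<omega>\<^sub>2 t" for t
  proof (cases "t \<in> {0..int N - 1}")
    case True
    then have "nat t < N" "int (nat t) = t" by auto
    then show ?thesis using inside[of "nat t"] by simp
  qed (rule outside)
  have C0: "C \<noteq> 0" using s0 by (simp add: C_def)
  \<comment> \<open>Conjugation maps index 0 to its mirror image N - 1, where the same constant C
    relates the two weights.\<close>
  have "cnj C * cnj (laurent_coeff \<omega>\<^sub>2 0) = cnj (laurent_coeff \<omega>\<^sub>1 0)" using all by simp
  also have "\<dots> = C * laurent_coeff \<omega>\<^sub>2 (int N - 1 - 0)"
    using cnj_laurent_coeff[OF sym(1) N, of 0] all by simp
  also have "\<dots> = C * cnj (laurent_coeff \<omega>\<^sub>2 0)" by (simp add: cnj_laurent_coeff[OF sym(2) N])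
  finally have "cnj C = C" using nz(2)[of 0] N by simp
  then obtain c where c: "C = of_real c" by (metis Reals_cnj_iff Reals_cases)
  have AE: "AE z in circle_measure. \<omega>\<^sub>1 z = of_real c * \<omega>\<^sub>2 z"
    using AE_eq_mult_of_laurent_coeff[OF int all] c by simp
  \<comment> \<open>The two positive normalisations differ by the factor c to the power N, which
    determines the sign of c only for odd N.\<close>
  have "c > 0" if "odd N"
  proof -
    have "(\<Prod>j<N. laurent_coeff \<omega>\<^sub>1 (int j)) = of_real (c ^ N) * (\<Prod>j<N. laurent_coeff \<omega>\<^sub>2 (int j))"
      by (simp add: all c prod.distrib)
    then have "Re (\<Prod>j<N. laurent_coeff \<omega>\<^sub>1 (int j)) = c ^ N * Re (\<Prod>j<N. laurent_coeff \<omega>\<^sub>2 (int j))"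
      by (simp only: Re_complex_of_real times_complex.sel Im_complex_of_real)
    then have "c ^ N > 0" using pos by (metis zero_less_mult_pos2)
    then show ?thesis using that N by (simp add: zero_less_power_eq)
  qed
  then show ?thesis using AE C0 c by auto
qed

end
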